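(* Let $\phi_1$ and $\phi_2$ be two complex-valued functions of the complex variables $a$ and $b$ that are holomorphic in a domain $G\subseteq\mathrm{B}=\mathbb{C}^2$. Let $S(\Gamma)$ be an orientable surface in $G$ bounded by the closed curve $\Gamma$. Then $$\int_\Gamma \phi_1\cdot da+\phi_2\cdot db=\int_{S(\Gamma)}\left(\frac{\partial\phi_2}{\partial a}-\frac{\partial\phi_1}{\partial b}\right)\cdot da\cdot db.$$
   Context: $\mathrm{B}=\mathbb{C}^2$ with points $(a,b)$, $a=x+iy$, $b=z+iu$ ($x,y,z,u$ real). A domain is a connected open set. A complex-valued function on $G$ is holomorphic in $G$ if its complex partial derivatives with respect to $a$ and $b$ exist throughout $G$. Curves are piecewise continuously differentiable. Surfaces are two-dimensional compact piecewise smooth surfaces in $\mathbb{R}^4=\mathbb{C}^2$; $S(\Gamma)$ is oriented and $\Gamma$ carries the induced boundary orientation, as in Stokes' theorem. The complex line and surface integrals are defined by reduction to real ones by expanding $da=dx+i\,dy$, $db=dz+i\,du$: for $\phi=\xi_1+i\xi_2$ and $\omega=\eta_1+i\eta_2$, $$\int_\Gamma\phi\cdot da+\omega\cdot db=\int_\Gamma(\xi_1dx-\xi_2dy+\eta_1dz-\eta_2du)+i\int_\Gamma(\xi_2dx+\xi_1dy+\eta_2dz+\eta_1du),$$ $$\int_{S(\Gamma)}\phi\cdot da\cdot db=\int_{S(\Gamma)}(\xi_1\,dx\,dz-\xi_1\,dy\,du-\xi_2\,dx\,du-\xi_2\,dy\,dz)+i\int_{S(\Gamma)}(\xi_1\,dx\,du+\xi_1\,dy\,dz+\xi_2\,dx\,dz-\xi_2\,dy\,du),$$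 where $dx\,dz$ etc. denote the oriented area elements (the 2-forms $dx\wedge dz$ etc.) as in the generalized Stokes theorem in $\mathbb{R}^4$. *)

theory Defs
  imports "HOL-Analysis.Analysis"
begin

section \<open>Functions of two complex variables\<close>

type_synonym point = "complex \<times> complex"

definition partial_a :: "(point \<Rightarrow> complex) \<Rightarrow> point \<Rightarrow> complex" where
  "partial_a \<phi> p = deriv (\<lambda>a. \<phi> (a, snd p)) (fst p)"

definition partial_b :: "(point \<Rightarrow> complex) \<Rightarrow> point \<Rightarrow> complex" where
  "partial_b \<phi> p = deriv (\<lambda>b. \<phi> (fst p, b)) (snd p)"

text \<open>Only the existence of the two complex partial derivatives is required; joint continuity
  is not part of the definition.\<close>

definition holomorphic2_on :: "(point \<Rightarrow> complex) \<Rightarrow> point set \<Rightarrow> bool" where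
  "holomorphic2_on \<phi> G \<longleftrightarrow>
     (\<forall>p\<in>G. (\<lambda>a. \<phi> (a, snd p)) field_differentiable (at (fst p)) \<and>
            (\<lambda>b. \<phi> (fst p, b)) field_differentiable (at (snd p)))"

text \<open>The real coordinates of \<open>(a, b)\<close>, where \<open>a = x + \<i> y\<close> and \<open>b = z + \<i> u\<close>.\<close>

definition crd_x :: "point \<Rightarrow> real" where "crd_x p = Re (fst p)"
definition crd_y :: "point \<Rightarrow> real" where "crd_y p = Im (fst p)"
definition crd_z :: "point \<Rightarrow> real" where "crd_z p = Re (snd p)"
definition crd_u :: "point \<Rightarrow> real" where "crd_u p = Im (snd p)"


section \<open>Line integrals\<close>

text \<open>The integral of \<open>P dx + Q dy + R dz + T du\<close> along \<open>\<gamma>\<close>.\<close>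

definition real_line_integral ::
  "(point \<Rightarrow> real) \<Rightarrow> (point \<Rightarrow> real) \<Rightarrow> (point \<Rightarrow> real) \<Rightarrow> (point \<Rightarrow> real) \<Rightarrow> (real \<Rightarrow> point) \<Rightarrow> real"
where
  "real_line_integral P Q R T \<gamma> =
     integral {0..1} (\<lambda>t. let v = vector_derivative \<gamma> (at t within {0..1}) in
       P (\<gamma> t) * crd_x v + Q (\<gamma> t) * crd_y v + R (\<gamma> t) * crd_z v + T (\<gamma> t) * crd_u v)"

text \<open>The integral of \<open>\<phi> da + \<omega> db\<close> along \<open>\<gamma>\<close>.\<close>

definition complex_line_integral ::
  "(point \<Rightarrow> complex) \<Rightarrow> (point \<Rightarrow> complex) \<Rightarrow> (real \<Rightarrow> point) \<Rightarrow> complex" where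
  "complex_line_integral \<phi> \<omega> \<gamma> =
     (let \<xi>1 = \<lambda>p. Re (\<phi> p); \<xi>2 = \<lambda>p. Im (\<phi> p); \<eta>1 = \<lambda>p. Re (\<omega> p); \<eta>2 = \<lambda>p. Im (\<omega> p) in
        complex_of_real (real_line_integral \<xi>1 (\<lambda>p. - \<xi>2 p) \<eta>1 (\<lambda>p. - \<eta>2 p) \<gamma>)
        + \<i> * complex_of_real (real_line_integral \<xi>2 \<xi>1 \<eta>2 \<eta>1 \<gamma>))"


section \<open>Smooth patches\<close>

text \<open>A patch is parametrized by the closed unit square, whose standard orientation it carries
  over to the surface. Derivatives on the sides of the square are one-sided.\<close>

type_synonym patch = "real \<times> real \<Rightarrow> point"

abbreviation unit_square :: "(real \<times> real) set" where
  "unit_square \<equiv> {0..1} \<times> {0..1}"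

definition patch_d1 :: "patch \<Rightarrow> real \<times> real \<Rightarrow> point" where
  "patch_d1 \<sigma> q = vector_derivative (\<lambda>s. \<sigma> (s, snd q)) (at (fst q) within {0..1})"

definition patch_d2 :: "patch \<Rightarrow> real \<times> real \<Rightarrow> point" where
  "patch_d2 \<sigma> q = vector_derivative (\<lambda>t. \<sigma> (fst q, t)) (at (snd q) within {0..1})"

text \<open>An injective, regular (the two tangent vectors are linearly independent over the reals),
  continuously differentiable patch.\<close>

definition smooth_patch :: "patch \<Rightarrow> bool" where
  "smooth_patch \<sigma> \<longleftrightarrow>
     inj_on \<sigma> unit_square \<and>
     (\<forall>q\<in>unit_square. (\<lambda>s. \<sigma> (s, snd q)) differentiable (at (fst q) within {0..1}) \<and>
                      (\<lambda>t. \<sigma> (fst q, t)) differentiable (at (snd q) within {0..1})) \<and>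
     continuous_on unit_square (patch_d1 \<sigma>) \<and>
     continuous_on unit_square (patch_d2 \<sigma>) \<and>
     (\<forall>q\<in>unit_square. \<forall>c d. c *\<^sub>R patch_d1 \<sigma> q + d *\<^sub>R patch_d2 \<sigma> q = 0 \<longrightarrow> c = 0 \<and> d = 0)"

text \<open>The sides of a patch, for \<open>k < 4\<close>, run through counterclockwise, that is, in the direction
  induced by the orientation of the square.\<close>

definition patch_side :: "patch \<Rightarrow> nat \<Rightarrow> real \<Rightarrow> point" where
  "patch_side \<sigma> k t = \<sigma> ([(t, 0), (1, t), (1 - t, 1), (0, 1 - t)] ! k)"

definition patch_corners :: "patch \<Rightarrow> point set" where
  "patch_corners \<sigma> = \<sigma> ` ({0, 1} \<times> {0, 1})"


section \<open>Oriented piecewise smooth surfaces\<close>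

text \<open>A compact oriented piecewise smooth surface is presented by the finite list of its smooth
  patches. Every compact piecewise smooth surface can be cut up in this way: a triangular piece
  splits into three quadrangular ones.\<close>

definition surface_set :: "patch list \<Rightarrow> point set" where
  "surface_set S = (\<Union>\<sigma>\<in>set S. \<sigma> ` unit_square)"

text \<open>Two-dimensional topological manifold, possibly with boundary, in the subspace topology.\<close>

definition surface_with_boundary :: "point set \<Rightarrow> bool" where
  "surface_with_boundary M \<longleftrightarrow>
     (\<forall>p\<in>M. \<exists>U V. p \<in> U \<and> openin (top_of_set M) U \<and>
        openin (top_of_set {w::complex. 0 \<le> Im w}) V \<and> U homeomorphic V)"

text \<open>Different patches meet only in common corners and in whole common sides. A common side is
  run through in opposite directions from its two patches (for two simple arcs with the same image
  this can be read off from their end points): the orientations of the patches agree. In particular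
  a side belongs to at most two patches.\<close>

definition oriented_surface :: "patch list \<Rightarrow> bool" where
  "oriented_surface S \<longleftrightarrow>
     (\<forall>\<sigma>\<in>set S. smooth_patch \<sigma>) \<and>
     surface_with_boundary (surface_set S) \<and>
     (\<forall>i<length S. \<forall>j<length S. i \<noteq> j \<longrightarrow>
        (\<forall>p \<in> (S ! i) ` unit_square \<inter> (S ! j) ` unit_square.
           p \<in> patch_corners (S ! i) \<inter> patch_corners (S ! j) \<or>
           (\<exists>k<4. \<exists>l<4. p \<in> path_image (patch_side (S ! i) k) \<and>
              path_image (patch_side (S ! i) k) = path_image (patch_side (S ! j) l))) \<and>
        (\<forall>k<4. \<forall>l<4.
           path_image (patch_side (S ! i) k) = path_image (patch_side (S ! j) l) \<longrightarrow>
             pathstart (patch_side (S ! i) k) = pathfinish (patch_side (S ! j) l) \<and>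
             pathfinish (patch_side (S ! i) k) = pathstart (patch_side (S ! j) l)))"

text \<open>The sides that make up the boundary: those belonging to one patch only. They are given by
  the index of the patch and the number of the side.\<close>

definition boundary_sides :: "patch list \<Rightarrow> (nat \<times> nat) set" where
  "boundary_sides S =
     {(i, k). i < length S \<and> k < 4 \<and>
        (\<forall>j<length S. \<forall>l<4. j \<noteq> i \<longrightarrow>
           path_image (patch_side (S ! j) l) \<noteq> path_image (patch_side (S ! i) k))}"

text \<open>The surface is bounded by the closed curve \<open>\<Gamma>\<close>, which carries the induced orientation:
  \<open>\<Gamma>\<close> runs once through the whole boundary, and inside each boundary side its tangent vector is a
  nonnegative multiple of the tangent vector of the side (zero is allowed because \<open>\<Gamma>\<close> may be
  momentarily at rest). The base point of \<open>\<Gamma>\<close> may be any point of the boundary.\<close>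

definition bounded_by :: "patch list \<Rightarrow> (real \<Rightarrow> point) \<Rightarrow> bool" where
  "bounded_by S \<Gamma> \<longleftrightarrow>
     valid_path \<Gamma> \<and> simple_path \<Gamma> \<and> pathfinish \<Gamma> = pathstart \<Gamma> \<and>
     path_image \<Gamma> = (\<Union>(i, k)\<in>boundary_sides S. path_image (patch_side (S ! i) k)) \<and>
     (\<forall>(i, k)\<in>boundary_sides S. \<forall>s\<in>{0<..<1}. \<forall>t\<in>{0<..<1}.
        \<Gamma> t = patch_side (S ! i) k s \<and> \<Gamma> differentiable (at t) \<longrightarrow>
          (\<exists>c\<ge>0. vector_derivative \<Gamma> (at t)
                  = c *\<^sub>R vector_derivative (patch_side (S ! i) k) (at s)))"


section \<open>Surface integrals\<close>

text \<open>The coefficient of the pull-back of \<open>df \<and> dg\<close> to the parameter square, for real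
  coordinates (hence linear) \<open>f\<close> and \<open>g\<close>.\<close>

definition area_element ::
  "(point \<Rightarrow> real) \<Rightarrow> (point \<Rightarrow> real) \<Rightarrow> patch \<Rightarrow> real \<times> real \<Rightarrow> real" where
  "area_element f g \<sigma> q =
     f (patch_d1 \<sigma> q) * g (patch_d2 \<sigma> q) - f (patch_d2 \<sigma> q) * g (patch_d1 \<sigma> q)"

text \<open>The integral of \<open>A dx dz + B dy du + C dx du + D dy dz\<close> over the surface.\<close>

definition real_surface_integral ::
  "(point \<Rightarrow> real) \<Rightarrow> (point \<Rightarrow> real) \<Rightarrow> (point \<Rightarrow> real) \<Rightarrow> (point \<Rightarrow> real) \<Rightarrow> patch list \<Rightarrow> real"
where
  "real_surface_integral A B C D S =
     (\<Sum>\<sigma>\<leftarrow>S. integral unit_square (\<lambda>q.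
        A (\<sigma> q) * area_element crd_x crd_z \<sigma> q + B (\<sigma> q) * area_element crd_y crd_u \<sigma> q +
        C (\<sigma> q) * area_element crd_x crd_u \<sigma> q + D (\<sigma> q) * area_element crd_y crd_z \<sigma> q))"

text \<open>The integral of \<open>\<phi> da db\<close> over the surface.\<close>

definition complex_surface_integral :: "(point \<Rightarrow> complex) \<Rightarrow> patch list \<Rightarrow> complex" where
  "complex_surface_integral \<phi> S =
     (let \<xi>1 = \<lambda>p. Re (\<phi> p); \<xi>2 = \<lambda>p. Im (\<phi> p) in
        complex_of_real (real_surface_integral \<xi>1 (\<lambda>p. - \<xi>1 p) (\<lambda>p. - \<xi>2 p) (\<lambda>p. - \<xi>2 p) S)
        + \<i> * complex_of_real (real_surface_integral \<xi>2 (\<lambda>p. - \<xi>2 p) \<xi>1 \<xi>1 S))"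

end

theory Submission
  imports Defs "HOL-Complex_Analysis.Complex_Analysis"
begin

text \<open>Hartogs' theorem makes the two functions jointly continuously differentiable: by Baire such a
  function is bounded on a thin polydisc, and the Hartogs lemma for its Taylor coefficients enlarges
  the polydisc. The pull-back of the form to the parameter square of a patch then satisfies Green's
  formula, which needs only continuous first derivatives, so the surface integral is the sum of the
  integrals over all sides. A side shared by two patches is run through in both directions and
  cancels. The integral over an arc depends only on the end points of the parametrization, so the
  loop contributes the integrals over the remaining sides.\<close>

section \<open>Harmonic majorants and the Hartogs lemma\<close>

text \<open>The difficulty is the weak notion of holomorphy: \<open>holomorphic2_on\<close> speaks
  of one variable at a time and does not by itself provide the joint continuity that Stokes' formula
  asks of a form and its derivatives. Once this is gained everything stays complex. The differential
  of a holomorphic function contains no conjugate differentials, so the exterior derivative of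
  \<phi>1 da + \<phi>2 db is a multiple of da db, and the real integrals of the definitions are real
  and imaginary parts of complex ones. Two further obstacles are geometric. The tangent vectors of a
  patch are merely continuous, so the coefficients of the pulled-back form cannot be differentiated;
  it has to be treated as a sum of terms f dg. And \<open>\<Gamma>\<close> is not assembled from the
  sides: its base point, break points and speed are unrelated to theirs, and its velocity may
  vanish. It is therefore lifted through each side to a real function, differentiable wherever
  \<open>\<Gamma>\<close> is.\<close>

lemma circle_mean_value:
  assumes "h holomorphic_on UNIV"
  shows "((\<lambda>t. h (exp (2 * of_real pi * \<i> * of_real t))) has_integral h 0) {0..1}"
proof -
  have "((\<lambda>u. h u / (u - 0)) has_contour_integral 2 * of_real pi * \<i> * h 0) (circlepath 0 1)"
    by (rule Cauchy_integral_circlepath_simple) (auto intro: holomorphic_on_subset[OF assms])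
  \<comment> \<open>On the unit circle the derivative of the parametrization is 2 pi i u, which
    cancels the denominator u of Cauchy's formula.\<close>
  then have "((\<lambda>t. 2 * of_real pi * \<i> * h (exp (2 * of_real pi * \<i> * of_real t)))
      has_integral 2 * of_real pi * \<i> * h 0) {0..1}"
    unfolding has_contour_integral_def
    by (rule has_integral_eq[rotated])
       (simp add: vector_derivative_circlepath01, simp add: circlepath)
  from has_integral_mult_right[OF this, of "1 / (2 * of_real pi * \<i>)"]
  show ?thesis by simp
qed

text \<open>On the circle Re z = (z + 1/z) / 2 and Im z = (z - 1/z) / (2 i), so real-linear
  functions become Laurent polynomials, a class closed under sums and products.\<close>

lemma real_polynomial_on_circle:
  fixes p :: "complex \<Rightarrow> real"
  assumes "real_polynomial_function p"
  shows "\<exists>P N. \<forall>z. norm z = 1 \<longrightarrow> complex_of_real (p z) = poly P z / z ^ N"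
  using assms
proof induction
  case (linear f)
  interpret bounded_linear f by fact
  \<comment> \<open>Substituting these expressions into \<open>Re z * f 1 + Im z * f \<i>\<close>
    gives the coefficients of 1/z and of z.\<close>
  have "complex_of_real (f z) = poly [:(f 1 + \<i> * f \<i>) / 2, 0, (f 1 - \<i> * f \<i>) / 2:] z / z ^ 1"
    if z: "norm z = 1" for z
  proof -
    have nz: "z \<noteq> 0" using z by auto
    have inv: "1 / z = cnj z"
      using z nz complex_norm_square[of z] by (simp add: field_simps)
    have "f z = f (Re z *\<^sub>R 1 + Im z *\<^sub>R \<i>)"
      by (rule arg_cong[where f = f]) (simp add: complex_eq_iff)
    then have fz: "f z = Re z * f 1 + Im z * f \<i>"
      by (simp add: add scaleR)
    have "poly [:(f 1 + \<i> * f \<i>) / 2, 0, (f 1 - \<i> * f \<i>) / 2:] z / z ^ 1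
        = (f 1 + \<i> * f \<i>) / 2 * (1 / z) + (f 1 - \<i> * f \<i>) / 2 * z"
      using nz by (simp add: field_simps)
    also have "\<dots> = complex_of_real (f z)"
      unfolding inv fz by (simp add: complex_eq_iff field_simps)
    finally show ?thesis by simp
  qed
  then show ?case by blast
next
  case (const c)
  show ?case by (rule exI[of _ "[:of_real c:]"], rule exI[of _ 0]) simp
next
  case (add f g)
  then obtain P N Q M where
    *: "\<And>z. norm z = 1 \<Longrightarrow> complex_of_real (f z) = poly P z / z ^ N"
      "\<And>z. norm z = 1 \<Longrightarrow> complex_of_real (g z) = poly Q z / z ^ M" by metis
  show ?case
  proof (intro exI allI impI)
    fix z :: complex assume "norm z = 1"
    then show "complex_of_real (f z + g z) = poly (P * monom 1 M + Q * monom 1 N) z / z ^ (N + M)"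
      using *[of z] by (cases "z = 0") (auto simp: poly_monom power_add field_simps)
  qed
next
  case (mult f g)
  then obtain P N Q M where
    *: "\<And>z. norm z = 1 \<Longrightarrow> complex_of_real (f z) = poly P z / z ^ N"
      "\<And>z. norm z = 1 \<Longrightarrow> complex_of_real (g z) = poly Q z / z ^ M" by metis
  show ?case
  proof (intro exI allI impI)
    fix z :: complex assume "norm z = 1"
    then show "complex_of_real (f z * g z) = poly (P * Q) z / z ^ (N + M)"
      using *[of z] by (auto simp: power_add)
  qed
qed

text \<open>On the circle \<open>1 / z\<close> is the conjugate of \<open>z\<close>, so negative powers may be replaced by positive
  ones without changing the real part.\<close>

lemma Re_laurent_on_circle:
  "\<exists>h. h holomorphic_on UNIV \<and> (\<forall>z. norm z = 1 \<longrightarrow> Re (poly P z / z ^ N) = Re (h z))"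
proof (induction P arbitrary: N)
  case 0
  show ?case by (rule exI[of _ "\<lambda>_. 0"]) auto
next
  case (pCons a P)
  show ?case
  \<comment> \<open>Splitting off the lowest coefficient lowers the order of the pole by one; at
    order 0 the quotient is a polynomial and serves as \<open>h\<close> itself.\<close>
  proof (cases N)
    case 0
    show ?thesis
      by (rule exI[of _ "poly (pCons a P)"]) (auto simp: 0 intro!: holomorphic_intros)
  next
    case (Suc M)
    obtain h where h: "h holomorphic_on UNIV"
      "\<And>z. norm z = 1 \<Longrightarrow> Re (poly P z / z ^ M) = Re (h z)" using pCons.IH by blast
    show ?thesis
    proof (intro exI conjI allI impI)
      show "(\<lambda>z. cnj a * z ^ N + h z) holomorphic_on UNIV"
        using h(1) by (intro holomorphic_intros)
      fix z :: complex assume z: "norm z = 1"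
      then have nz: "z \<noteq> 0" by auto
      have "1 / z ^ N = cnj (z ^ N)"
        using complex_norm_square[of "z ^ N"] z nz by (simp add: norm_power field_simps)
      then have "a / z ^ N = cnj (cnj a * z ^ N)"
        by (metis complex_cnj_cnj complex_cnj_mult mult.right_neutral times_divide_eq_right)
      then have 1: "Re (a / z ^ N) = Re (cnj a * z ^ N)"
        by (metis complex_cnj(1) complex_surj complex.sel(1))
      have "poly (pCons a P) z / z ^ N = a / z ^ N + poly P z / z ^ M"
        using nz by (simp add: Suc field_simps)
      then show "Re (poly (pCons a P) z / z ^ N) = Re (cnj a * z ^ N + h z)"
        using 1 h(2)[OF z] by simp
    qed
  qed
qed

text \<open>Replaces the Poisson integral: boundary values are approximated by a real polynomial
  (Stone-Weierstrass), which on the circle is the real part of an entire function. The harmonic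
  function so obtained extends past the circle, so no boundary behaviour has to be
  discussed.\<close>

lemma circle_approximation:
  fixes u :: "complex \<Rightarrow> real"
  assumes "continuous_on (sphere 0 1) u" "e > 0"
  obtains h where "h holomorphic_on UNIV" "\<And>z. norm z = 1 \<Longrightarrow> \<bar>u z - Re (h z)\<bar> < e"
proof -
  obtain p where p: "real_polynomial_function p" "\<And>z. z \<in> sphere 0 1 \<Longrightarrow> \<bar>u z - p z\<bar> < e"
    using Stone_Weierstrass_real_polynomial_function[OF compact_sphere assms] by blast
  obtain P N where P: "\<And>z. norm z = 1 \<Longrightarrow> complex_of_real (p z) = poly P z / z ^ N"
    using real_polynomial_on_circle[OF p(1)] by blast
  obtain h where h: "h holomorphic_on UNIV"
    "\<And>z. norm z = 1 \<Longrightarrow> Re (poly P z / z ^ N) = Re (h z)"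
    using Re_laurent_on_circle by blast
  show ?thesis
  proof (rule that[OF h(1)])
    fix z :: complex assume z: "norm z = 1"
    have "Re (h z) = p z" using P[OF z] h(2)[OF z] by (metis Re_complex_of_real)
    then show "\<bar>u z - Re (h z)\<bar> < e" using p(2) z by simp
  qed
qed

lemma maximum_modulus_disc:
  assumes "f holomorphic_on ball 0 1" "continuous_on (cball 0 1) f"
    "\<And>z. norm z = 1 \<Longrightarrow> norm (f z) \<le> B" "norm z \<le> 1"
  shows "norm (f z) \<le> B"
  by (rule maximum_modulus_frontier[of f "cball 0 1"]) (use assms in auto)

text \<open>After normalization the Moebius map \<open>(k z - A) / (k z + A)\<close> carries the
  right half-plane to the unit disc and the value at 0 to 0, so Schwarz's lemma bounds it by 1/2 at
  \<open>b\<close>. The factor 3 is (1 + 1/2) / (1 - 1/2).\<close>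

lemma harnack_disc:
  assumes h: "h holomorphic_on UNIV" and pos: "\<And>z. norm z = 1 \<Longrightarrow> 0 \<le> Re (h z)"
    and b: "norm b \<le> 1/2"
  shows "Re (h b) \<le> 3 * Re (h 0)"
proof -
  have cont: "continuous_on A h" for A
    using h holomorphic_on_imp_continuous_on continuous_on_subset by blast
  have hol: "h holomorphic_on A" for A using h holomorphic_on_subset by blast
  have nonneg: "0 \<le> Re (h z)" if "norm z \<le> 1" for z
  proof -
    \<comment> \<open>Since \<open>exp (- h z)\<close> has modulus \<open>exp (- Re (h z))\<close>,
      the minimum principle for the harmonic function reduces to the maximum modulus
      principle.\<close>
    have "norm (exp (- h z)) \<le> 1"
      by (rule maximum_modulus_disc[of "\<lambda>z. exp (- h z)"])
         (use that pos cont hol in \<open>auto intro!: holomorphic_intros continuous_intros\<close>)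
    then show ?thesis by simp
  qed
  have *: "Re (h b) + d \<le> 3 * (Re (h 0) + d)" if d: "d > 0" for d
  proof -
    define A where "A = Re (h 0) + d"
    have A: "A > 0" using nonneg[of 0] d by (simp add: A_def)
    \<comment> \<open>Removing the imaginary part at 0 makes \<open>k 0\<close> the real number
      \<open>A\<close>; the shift by \<open>d\<close> makes the real part strictly positive.\<close>
    define k where "k z = h z - \<i> * Im (h 0) + d" for z
    have k0: "k 0 = A" by (simp add: k_def A_def complex_eq_iff)
    have Rek: "Re (k z) > 0" if "norm z \<le> 1" for z using nonneg[OF that] d by (simp add: k_def)
    define F where "F z = (k z - A) / (k z + A)" for z
    have nz: "k z + A \<noteq> 0" if "norm z \<le> 1" for z
      using Rek[OF that] A by (auto simp: complex_eq_iff)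
    have "norm (F b) \<le> norm b"
    proof (rule Schwarz_Lemma(1))
      have "k holomorphic_on ball 0 1" unfolding k_def by (intro holomorphic_intros hol)
      then show "F holomorphic_on ball 0 1"
        unfolding F_def using nz by (intro holomorphic_intros) auto
      show "F 0 = 0" by (simp add: F_def k0)
      show "norm (F z) < 1" if "norm z < 1" for z
      proof -
        \<comment> \<open>The two squares differ by 4 A Re (k z).\<close>
        have "(norm (k z - A))\<^sup>2 < (norm (k z + A))\<^sup>2"
          using Rek[of z] that A unfolding cmod_power2 by (simp add: power2_eq_square algebra_simps)
        then have "norm (k z - A) < norm (k z + A)" by (rule power2_less_imp_less) simp
        then show ?thesis by (simp add: F_def norm_divide divide_simps nz)
      qed
    qed (use b in auto)
    then have F: "norm (F b) \<le> 1/2" using b by simp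
    have nzb: "k b + A \<noteq> 0" using nz[of b] b by simp
    have "k b - A = F b * (k b + A)" using nzb by (simp add: F_def)
    then have "norm (k b - A) \<le> 1/2 * norm (k b + A)"
      using F by (metis mult_right_mono norm_ge_zero norm_mult)
    moreover have "norm (k b) - A \<le> norm (k b - A)" "norm (k b + A) \<le> norm (k b) + A"
      using norm_triangle_ineq2[of "k b" A] norm_triangle_ineq[of "k b" A] A by auto
    \<comment> \<open>Together these give
      \<open>norm (k b) - A \<le> (norm (k b) + A) / 2\<close>.\<close>
    ultimately have "norm (k b) \<le> 3 * A" by simp
    then show ?thesis
      using complex_Re_le_cmod[of "k b"] by (simp add: k_def A_def)
  qed
  have "Re (h b) \<le> 3 * Re (h 0) + e" if "e > 0" for e
    using *[of "e / 2"] that by (simp add: algebra_simps)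
  then show ?thesis by (rule field_le_epsilon)
qed

text \<open>The functions \<open>ln (max 1 \<bar>g n\<bar>) / n\<close> tend to \<open>0\<close> pointwise and boundedly on the circle, hence
  in mean. A harmonic majorant with nearly the same mean is small on the smaller disc by Harnack,
  and dominates there by the maximum principle.\<close>

lemma hartogs_lemma:
  fixes g :: "nat \<Rightarrow> complex \<Rightarrow> complex"
  assumes hol: "\<And>n. g n holomorphic_on ball 0 1"
    and cont: "\<And>n. continuous_on (cball 0 1) (g n)"
    and K: "\<And>n z. norm z \<le> 1 \<Longrightarrow> norm (g n z) \<le> K ^ Suc n"
    and bd: "\<And>z. norm z = 1 \<Longrightarrow> \<exists>B. \<forall>n. norm (g n z) \<le> B"
    and q: "q > 1"
  shows "\<forall>\<^sub>F n in sequentially. \<forall>z. norm z \<le> 1/2 \<longrightarrow> norm (g n z) \<le> q ^ Suc n"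
proof -
  \<comment> \<open>The maximum with 1 keeps the logarithm continuous across the zeros of
    \<open>g n\<close> and makes \<open>u n\<close> nonnegative; \<open>Suc n\<close> makes the
    division meaningful at n = 0.\<close>
  define u where "u n z = ln (max 1 (norm (g n z))) / Suc n" for n z
  define E where "E t = exp (2 * of_real pi * \<i> * complex_of_real t)" for t
  have E: "norm (E t) = 1" for t by (simp add: E_def)
  have contE: "continuous_on A E" for A unfolding E_def by (intro continuous_intros)
  have contu: "continuous_on (sphere 0 1) (u n)" for n
    unfolding u_def
    by (intro continuous_intros continuous_on_subset[OF cont]) (auto simp: max_def)
  have u_nonneg: "0 \<le> u n z" for n z by (simp add: u_def)
  define C where "C = ln (max 1 K)"
  have uC: "u n z \<le> C" if "norm z = 1" for n z
  proof -
    have "0 \<le> K" using K[of 0 0] by (smt (verit) norm_ge_zero norm_zero power_one_right One_nat_def)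
    have "max 1 (norm (g n z)) \<le> max 1 K ^ Suc n"
    proof (intro max.boundedI)
      show "1 \<le> max 1 K ^ Suc n" by (rule one_le_power) simp
      have "norm (g n z) \<le> K ^ Suc n" using K that by simp
      also have "\<dots> \<le> max 1 K ^ Suc n" using \<open>0 \<le> K\<close> by (intro power_mono) auto
      finally show "norm (g n z) \<le> max 1 K ^ Suc n" .
    qed
    then have "ln (max 1 (norm (g n z))) \<le> ln (max 1 K ^ Suc n)"
      by (subst ln_le_cancel_iff) auto
    also have "\<dots> = real (Suc n) * C" unfolding C_def by (subst ln_realpow) auto
    finally show ?thesis by (simp add: u_def field_simps)
  qed
  have contuE: "continuous_on {0..1} (\<lambda>t. u n (E t))" for n
    by (rule continuous_on_compose2[OF contu contE]) (auto simp: E)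
  have int: "(\<lambda>t. u n (E t)) integrable_on {0..1}" for n
    by (rule integrable_continuous_real[OF contuE])
  have ulim: "(\<lambda>n. u n z) \<longlonglongrightarrow> 0" if z: "norm z = 1" for z
  proof -
    obtain B where B: "\<And>n. norm (g n z) \<le> B" using bd[OF z] by blast
    have le: "u n z \<le> ln (max 1 B) / Suc n" for n
    proof -
      have "ln (max 1 (norm (g n z))) \<le> ln (max 1 B)"
        by (subst ln_le_cancel_iff) (use B[of n] in auto)
      then show ?thesis unfolding u_def by (intro divide_right_mono) auto
    qed
    have "(\<lambda>n. ln (max 1 B) / Suc n) \<longlonglongrightarrow> 0"
      by (rule LIMSEQ_Suc[OF lim_const_over_n])
    then show ?thesis
      by (rule tendsto_sandwich[rotated 3]) (use u_nonneg le in auto)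
  qed
  have "(\<lambda>n. integral {0..1} (\<lambda>t. u n (E t))) \<longlonglongrightarrow> integral {0..1} (\<lambda>t::real. 0::real)"
  proof (rule dominated_convergence(2)[where h = "\<lambda>_. C"])
    show "norm (u n (E t)) \<le> C" for n t
      using u_nonneg[of n "E t"] uC[OF E[of t], of n] by simp
  qed (use int E ulim in \<open>simp_all add: integrable_const_ivl\<close>)
  \<comment> \<open>The majorant will have mean at most 3 e, and Harnack multiplies by 3: the total
    9 e must be \<open>ln q\<close>.\<close>
  moreover define e where "e = ln q / 9"
  moreover have e: "e > 0" using q by (simp add: e_def)
  ultimately have "\<forall>\<^sub>F n in sequentially. integral {0..1} (\<lambda>t. u n (E t)) < e"
    by (simp add: order_tendsto_iff)
  then show ?thesis
  proof eventually_elim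
    case (elim n)
    \<comment> \<open>Aiming at \<open>u n z + e\<close> with error below \<open>e\<close> places
      \<open>Re (h z)\<close> between \<open>u n z\<close> and \<open>u n z + 2 * e\<close>.\<close>
    have "continuous_on (sphere 0 1) (\<lambda>z. u n z + e)" by (intro continuous_intros contu)
    then obtain h where h: "h holomorphic_on UNIV"
      and ha: "\<And>z. norm z = 1 \<Longrightarrow> \<bar>u n z + e - Re (h z)\<bar> < e"
      using circle_approximation[OF _ e] by blast
    have ha1: "u n z \<le> Re (h z)" "Re (h z) \<le> u n z + 2 * e" if "norm z = 1" for z
      using ha[OF that] by linarith+
    have "((\<lambda>t. Re (h (E t))) has_integral Re (h 0)) {0..1}"
      using has_integral_Re[OF circle_mean_value[OF h]] by (simp add: E_def)
    moreover have "((\<lambda>t. u n (E t) + 2 * e) has_integral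
        integral {0..1} (\<lambda>t. u n (E t)) + 2 * e) {0..1}"
      using has_integral_add[OF integrable_integral[OF int] has_integral_const_real[of "2 * e" 0 1]]
      by simp
    ultimately have "Re (h 0) \<le> integral {0..1} (\<lambda>t. u n (E t)) + 2 * e"
      by (rule has_integral_le) (use ha1 E in auto)
    with elim have h0: "Re (h 0) \<le> 3 * e" by simp
    have holh: "h holomorphic_on A" for A using h holomorphic_on_subset by blast
    then have conth: "continuous_on A h" for A by (rule holomorphic_on_imp_continuous_on)
    \<comment> \<open>The comparison of the logarithm of \<open>norm (g n z)\<close> with its
      harmonic majorant becomes a bound by 1 for this holomorphic product, so the maximum modulus
      principle applies and zeros of \<open>g n\<close> are no exception.\<close>
    have norm_eq: "norm (g n z * exp (- (of_nat (Suc n) * h z))) = norm (g n z) / exp (Suc n * Re (h z))" for z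
      by (simp add: norm_mult norm_divide exp_minus divide_inverse norm_inverse del: of_nat_Suc)
    have circ: "norm (g n z * exp (- (of_nat (Suc n) * h z))) \<le> 1" if z: "norm z = 1" for z
    proof -
      have "norm (g n z) \<le> exp (Suc n * u n z)" by (simp add: u_def del: of_nat_Suc)
      also have "\<dots> \<le> exp (Suc n * Re (h z))"
        using ha1(1)[OF z] by (simp del: of_nat_Suc)
      finally show ?thesis by (simp add: norm_eq del: of_nat_Suc)
    qed
    show ?case
    proof (intro allI impI)
      fix z :: complex assume z: "norm z \<le> 1/2"
      have "norm (g n z * exp (- (of_nat (Suc n) * h z))) \<le> 1"
        by (rule maximum_modulus_disc)
           (use z hol cont circ in \<open>auto intro!: holomorphic_intros continuous_intros holh conth\<close>)
      then have "norm (g n z) \<le> exp (Suc n * Re (h z))"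
        by (simp add: norm_eq del: of_nat_Suc)
      also have "Re (h z) \<le> 3 * Re (h 0)"
        by (rule harnack_disc[OF h _ z]) (rule order_trans[OF u_nonneg ha1(1)])
      then have "Re (h z) \<le> ln q" using h0 by (simp add: e_def)
      then have "exp (Suc n * Re (h z)) \<le> exp (Suc n * ln q)" by (simp del: of_nat_Suc)
      also have "\<dots> = q ^ Suc n" using q by (subst exp_of_nat_mult) simp
      finally show "norm (g n z) \<le> q ^ Suc n" .
    qed
  qed
qed

section \<open>Separately holomorphic functions\<close>

lemma box_in_open:
  fixes G :: "(complex \<times> complex) set"
  assumes "open G" "(a, b) \<in> G"
  obtains e where "e > 0" "cball a e \<times> cball b e \<subseteq> G"
proof -
  obtain A B where AB: "open A" "open B" "a \<in> A" "b \<in> B" "A \<times> B \<subseteq> G"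
    using assms by (auto elim!: open_prod_elim)
  obtain e1 e2 where e: "e1 > 0" "cball a e1 \<subseteq> A" "e2 > 0" "cball b e2 \<subseteq> B"
    using AB by (meson open_contains_cball)
  show ?thesis
  proof (rule that[of "min e1 e2"])
    show "cball a (min e1 e2) \<times> cball b (min e1 e2) \<subseteq> G" using e AB(5) by fastforce
  qed (use e in auto)
qed

lemma holomorphic2_on_slice:
  assumes "holomorphic2_on f G"
  shows "A \<times> {b} \<subseteq> G \<Longrightarrow> (\<lambda>a. f (a, b)) holomorphic_on A"
    and "{a} \<times> B \<subseteq> G \<Longrightarrow> (\<lambda>b. f (a, b)) holomorphic_on B"
proof -
  show "(\<lambda>a. f (a, b)) holomorphic_on A" if "A \<times> {b} \<subseteq> G"
    unfolding holomorphic_on_def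
  proof
    fix z assume "z \<in> A"
    then have "(z, b) \<in> G" using that by blast
    with assms show "(\<lambda>a. f (a, b)) field_differentiable at z within A"
      unfolding holomorphic2_on_def by (auto dest!: bspec intro: field_differentiable_at_within)
  qed
  show "(\<lambda>b. f (a, b)) holomorphic_on B" if "{a} \<times> B \<subseteq> G"
    unfolding holomorphic_on_def
  proof
    fix z assume "z \<in> B"
    then have "(a, z) \<in> G" using that by blast
    with assms show "(\<lambda>b. f (a, b)) field_differentiable at z within B"
      unfolding holomorphic2_on_def by (auto dest!: bspec intro: field_differentiable_at_within)
  qed
qed

text \<open>The hypothesis of Osgood's lemma. It is the working notion because Cauchy's estimates
  make it stable under both partial derivatives, so that local bounds on \<open>f\<close> control
  derivatives of every order. Having the polydisc inside \<open>G\<close> builds openness of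
  \<open>G\<close> into the notion.\<close>

definition bounded_holomorphic2_on :: "(point \<Rightarrow> complex) \<Rightarrow> point set \<Rightarrow> bool" where
  "bounded_holomorphic2_on f G \<longleftrightarrow> holomorphic2_on f G \<and>
     (\<forall>(a, b)\<in>G. \<exists>e>0. \<exists>M. \<forall>a'\<in>cball a e. \<forall>b'\<in>cball b e. (a', b') \<in> G \<and> norm (f (a', b')) \<le> M)"

lemma bounded_holomorphic2_onE:
  assumes "bounded_holomorphic2_on f G" "(a, b) \<in> G"
  obtains e M where "e > 0" "M \<ge> 0" "cball a e \<times> cball b e \<subseteq> G"
    "\<forall>a'\<in>cball a e. \<forall>b'\<in>cball b e. norm (f (a', b')) \<le> M"
proof -
  obtain e M where e: "e > 0"
    "\<And>a' b'. a' \<in> cball a e \<Longrightarrow> b' \<in> cball b e \<Longrightarrow> (a', b') \<in> G \<and> norm (f (a', b')) \<le> M"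
    using assms unfolding bounded_holomorphic2_on_def by blast
  have "norm (f (a, b)) \<le> M" using e by simp
  then have "M \<ge> 0" using norm_ge_zero order_trans by blast
  moreover have "cball a e \<times> cball b e \<subseteq> G" using e(2) by auto
  ultimately show ?thesis using that e by blast
qed

text \<open>Every point of the half disc is the centre of a disc of radius \<open>e/2\<close> inside
  the large one, so one Cauchy estimate serves them all. Apart from \<open>n\<close> the bound
  depends on \<open>M\<close> and \<open>e\<close> alone, hence it will be uniform in the other
  variable.\<close>

lemma deriv_bound_half_disc:
  assumes "k holomorphic_on cball a e" "\<And>z. z \<in> cball a e \<Longrightarrow> norm (k z) \<le> M"
    and "e > 0" "z \<in> cball a (e/2)"
  shows "norm ((deriv ^^ n) k z) \<le> fact n * M / (e/2) ^ n"
proof (rule Cauchy_inequality)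
  have sub: "cball z (e/2) \<subseteq> cball a e"
  proof
    fix w assume "w \<in> cball z (e/2)"
    then show "w \<in> cball a e" using assms(4) dist_triangle[of a w z] by simp
  qed
  then show "k holomorphic_on ball z (e/2)" "continuous_on (cball z (e/2)) k"
    using assms(1) ball_subset_cball holomorphic_on_imp_continuous_on holomorphic_on_subset
    by blast+
  show "norm (k x) \<le> M" if "norm (z - x) = e/2" for x
    using sub that assms(2) by (auto simp: dist_norm subset_iff)
qed (use assms in auto)

lemma lipschitz_half_disc:
  assumes "k holomorphic_on cball a e" "\<And>z. z \<in> cball a e \<Longrightarrow> norm (k z) \<le> M"
    and "e > 0" "z \<in> cball a (e/2)"
  shows "norm (k z - k a) \<le> 2 * M / e * norm (z - a)"
proof (rule field_differentiable_bound[of "cball a (e/2)" k "deriv k"])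
  fix w assume w: "w \<in> cball a (e/2)"
  then have "w \<in> ball a e" using assms(3) by auto
  then have "k field_differentiable at w"
    using assms(1) holomorphic_on_imp_differentiable_at[of k "ball a e" w]
      holomorphic_on_subset[OF _ ball_subset_cball] by blast
  then show "(k has_field_derivative deriv k w) (at w within cball a (e/2))"
    using field_differentiable_derivI has_field_derivative_at_within by blast
  show "norm (deriv k w) \<le> 2 * M / e"
    using deriv_bound_half_disc[OF assms(1,2,3) w, of 1] by (simp add: mult.commute)
qed (use assms in auto)

text \<open>Going from (a, b) to (a', b') in one variable after the other, each leg is a
  one-variable Lipschitz estimate. The common bound \<open>M\<close> gives both legs the same
  constant, whatever the value of the variable held fixed.\<close>

lemma bounded_holomorphic2_on_continuous:
  assumes "bounded_holomorphic2_on f G"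
  shows "continuous_on G f"
proof -
  have hol: "holomorphic2_on f G" using assms by (simp add: bounded_holomorphic2_on_def)
  have "isCont f p" if pG: "p \<in> G" for p
  proof -
    obtain a b where p: "p = (a, b)" by (cases p)
    obtain e M where e: "e > 0" "M \<ge> 0" "cball a e \<times> cball b e \<subseteq> G"
      "\<forall>a'\<in>cball a e. \<forall>b'\<in>cball b e. norm (f (a', b')) \<le> M"
      by (rule bounded_holomorphic2_onE[OF assms pG[unfolded p]])
    have lip: "norm (f (a', b') - f (a, b)) \<le> 2 * M / e * norm (a' - a) + 2 * M / e * norm (b' - b)"
      if "a' \<in> cball a (e/2)" "b' \<in> cball b (e/2)" for a' b'
    proof -
      have 1: "norm (f (a', b') - f (a, b')) \<le> 2 * M / e * norm (a' - a)"
        by (rule lipschitz_half_disc[where k = "\<lambda>z. f (z, b')"])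
           (use that e in \<open>auto intro!: holomorphic2_on_slice[OF hol]\<close>)
      have 2: "norm (f (a, b') - f (a, b)) \<le> 2 * M / e * norm (b' - b)"
        by (rule lipschitz_half_disc[where k = "\<lambda>z. f (a, z)"])
           (use that e in \<open>auto intro!: holomorphic2_on_slice[OF hol]\<close>)
      show ?thesis using 1 2 norm_triangle_ineq[of "f (a', b') - f (a, b')" "f (a, b') - f (a, b)"]
        by simp
    qed
    have "((\<lambda>q. f q - f p) \<longlongrightarrow> 0) (at p)"
    proof (rule Lim_null_comparison)
      have "\<forall>\<^sub>F q in at p. q \<in> ball a (e/2) \<times> ball b (e/2)"
        by (rule eventually_at_in_open') (use e p in \<open>auto intro: open_Times\<close>)
      then show "\<forall>\<^sub>F q in at p. norm (f q - f p)
          \<le> 2 * M / e * norm (fst q - a) + 2 * M / e * norm (snd q - b)"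
        by eventually_elim (use lip p in auto)
      have "((\<lambda>q. 2 * M / e * norm (fst q - a) + 2 * M / e * norm (snd q - b))
          \<longlongrightarrow> 2 * M / e * norm (fst p - a) + 2 * M / e * norm (snd p - b)) (at p)"
        by (intro tendsto_intros)
      then show "((\<lambda>q. 2 * M / e * norm (fst q - a) + 2 * M / e * norm (snd q - b)) \<longlongrightarrow> 0) (at p)"
        by (simp add: p)
    qed
    then show ?thesis using LIM_zero_cancel isCont_def by blast
  qed
  then show ?thesis by (simp add: continuous_at_imp_continuous_on)
qed

text \<open>First-order Taylor expansion, with the second derivative bounded by Cauchy on the half
  disc; 8 is 2 * 2^2. The constant involves only \<open>M\<close> and \<open>e\<close>, which makes
  difference quotients of a function of two variables converge uniformly in the second one.\<close>

lemma difference_quotient_bound: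
  assumes k: "k holomorphic_on cball a e" "\<And>z. z \<in> cball a e \<Longrightarrow> norm (k z) \<le> M"
    and "e > 0" "norm h \<le> e/2" "h \<noteq> 0"
  shows "norm ((k (a + h) - k a) / h - deriv k a) \<le> 8 * M / e\<^sup>2 * norm h"
proof -
  have "norm ((deriv ^^ 0) k (a + h) - (\<Sum>i\<le>1. (deriv ^^ i) k a * ((a + h) - a) ^ i / fact i))
      \<le> 2 * M / (e/2)\<^sup>2 * norm ((a + h) - a) ^ Suc 1 / fact 1"
  proof (rule complex_Taylor[where S = "cball a (e/2)" and f = "\<lambda>i. (deriv ^^ i) k"])
    fix i :: nat and x assume x: "x \<in> cball a (e/2)" "i \<le> 1"
    have "(deriv ^^ i) k holomorphic_on ball a e"
      using k(1) by (intro holomorphic_higher_deriv holomorphic_on_subset[OF k(1)]) auto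
    moreover have "x \<in> ball a e" using x \<open>e > 0\<close> by auto
    ultimately have "((deriv ^^ i) k has_field_derivative deriv ((deriv ^^ i) k) x) (at x)"
      by (intro holomorphic_derivI[of _ "ball a e"]) auto
    then show "((deriv ^^ i) k has_field_derivative (deriv ^^ Suc i) k x) (at x within cball a (e/2))"
      by (simp add: has_field_derivative_at_within)
  next
    fix x assume "x \<in> cball a (e/2)"
    from deriv_bound_half_disc[OF k \<open>e > 0\<close> this, of "Suc 1"]
    show "norm ((deriv ^^ Suc 1) k x) \<le> 2 * M / (e/2)\<^sup>2" by (simp add: fact_numeral numeral_2_eq_2)
  qed (use assms in \<open>auto simp: dist_norm\<close>)
  then have "norm (k (a + h) - k a - deriv k a * h) \<le> 8 * M / e\<^sup>2 * (norm h)\<^sup>2"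
    by (simp add: power2_eq_square field_simps)
  moreover have "(k (a + h) - k a) / h - deriv k a = (k (a + h) - k a - deriv k a * h) / h"
    using \<open>h \<noteq> 0\<close> by (simp add: field_simps)
  ultimately show ?thesis
    using \<open>h \<noteq> 0\<close> by (simp add: norm_divide divide_le_eq power2_eq_square mult.assoc)
qed

text \<open>In its own variable the derivative is holomorphic by the classical theorem. In the other
  it is a locally uniform limit of difference quotients, each holomorphic there as a combination of
  two slices of \<open>f\<close>. The half polydisc carries the new local bound.\<close>

lemma bounded_holomorphic2_on_partial_a:
  assumes "bounded_holomorphic2_on f G"
  shows "bounded_holomorphic2_on (partial_a f) G"
proof -
  have hol: "holomorphic2_on f G" using assms by (simp add: bounded_holomorphic2_on_def)
  have *: "(\<lambda>a'. partial_a f (a', b)) field_differentiable (at a) \<and>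
      (\<lambda>b'. partial_a f (a, b')) field_differentiable (at b) \<and>
      (\<exists>e>0. \<exists>M. \<forall>a'\<in>cball a e. \<forall>b'\<in>cball b e. (a', b') \<in> G \<and> norm (partial_a f (a', b')) \<le> M)"
    if ab: "(a, b) \<in> G" for a b
  proof -
    obtain e M where e: "e > 0" "M \<ge> 0" "cball a e \<times> cball b e \<subseteq> G"
      "\<forall>a'\<in>cball a e. \<forall>b'\<in>cball b e. norm (f (a', b')) \<le> M"
      by (rule bounded_holomorphic2_onE[OF assms ab])
    have hola: "(\<lambda>z. f (z, b')) holomorphic_on cball a e" if "b' \<in> cball b e" for b'
      by (rule holomorphic2_on_slice[OF hol]) (use that e in auto)
    have "(\<lambda>a'. partial_a f (a', b)) holomorphic_on ball a e"
      unfolding partial_a_def fst_conv snd_conv using e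
      by (intro holomorphic_deriv holomorphic_on_subset[OF hola]) auto
    then have 1: "(\<lambda>a'. partial_a f (a', b)) field_differentiable (at a)"
      using e(1) by (auto intro: holomorphic_on_imp_differentiable_at)
    have 3: "\<forall>a'\<in>cball a (e/2). \<forall>b'\<in>cball b (e/2).
        (a', b') \<in> G \<and> norm (partial_a f (a', b')) \<le> 2 * M / e"
    proof (intro ballI conjI)
      fix a' b' assume ab': "a' \<in> cball a (e/2)" "b' \<in> cball b (e/2)"
      then have "a' \<in> cball a e" "b' \<in> cball b e" using e(1) by auto
      then show "(a', b') \<in> G" using e(3) by blast
      show "norm (partial_a f (a', b')) \<le> 2 * M / e"
        using deriv_bound_half_disc[OF hola, of b' M a' 1] e ab' \<open>b' \<in> cball b e\<close>
        by (simp add: partial_a_def mult.commute)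
    qed
    \<comment> \<open>Increments of size at most \<open>e/2\<close>, as the estimate on difference
      quotients requires; \<open>Suc n\<close> keeps them nonzero at n = 0.\<close>
    define h where "h n = complex_of_real (e / 2 / real (Suc n))" for n
    have h: "h n \<noteq> 0" "norm (h n) \<le> e/2" for n
      using e(1) by (auto simp: h_def norm_divide divide_le_eq mult_le_cancel_left1 simp del: of_nat_Suc)
    have h0: "(\<lambda>n. norm (h n)) \<longlonglongrightarrow> 0"
    proof -
      have "(\<lambda>n. e / 2 / real (Suc n)) \<longlonglongrightarrow> 0" by (rule LIMSEQ_Suc[OF lim_const_over_n])
      then show ?thesis using e(1) by (simp add: h_def norm_divide del: of_nat_Suc)
    qed
    have "(\<lambda>b'. partial_a f (a, b')) holomorphic_on ball b e"
    proof (rule holomorphic_uniform_sequence[where f = "\<lambda>n b'. (f (a + h n, b') - f (a, b')) / h n"])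
      fix n
      have "a + h n \<in> cball a e" using h(2)[of n] e(1) by (auto simp: dist_norm)
      then show "(\<lambda>b'. (f (a + h n, b') - f (a, b')) / h n) holomorphic_on ball b e"
        by (intro holomorphic_intros holomorphic2_on_slice[OF hol]) (use e h in auto)
    next
      fix x assume "x \<in> ball b e"
      then obtain d where d: "d > 0" "cball x d \<subseteq> ball b e"
        by (metis open_ball open_contains_cball)
      moreover have "uniform_limit (cball x d) (\<lambda>n b'. (f (a + h n, b') - f (a, b')) / h n)
         (\<lambda>b'. partial_a f (a, b')) sequentially"
      proof (rule uniform_limitI)
        fix eps :: real assume "eps > 0"
        have "(\<lambda>n. 8 * M / e\<^sup>2 * norm (h n)) \<longlonglongrightarrow> 8 * M / e\<^sup>2 * 0" by (intro tendsto_intros h0)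
        then have "\<forall>\<^sub>F n in sequentially. 8 * M / e\<^sup>2 * norm (h n) < eps"
          using \<open>eps > 0\<close> by (simp add: order_tendsto_iff)
        then show "\<forall>\<^sub>F n in sequentially. \<forall>b'\<in>cball x d.
            dist ((f (a + h n, b') - f (a, b')) / h n) (partial_a f (a, b')) < eps"
        proof eventually_elim
          case (elim n)
          show ?case
          proof
            fix b' assume "b' \<in> cball x d"
            then have b': "b' \<in> cball b e" using d by (meson ball_subset_cball subsetD)
            have "norm ((f (a + h n, b') - f (a, b')) / h n - partial_a f (a, b'))
                \<le> 8 * M / e\<^sup>2 * norm (h n)"
              unfolding partial_a_def fst_conv snd_conv
              by (rule difference_quotient_bound[OF hola[OF b']]) (use e h b' in auto)
            then show "dist ((f (a + h n, b') - f (a, b')) / h n) (partial_a f (a, b')) < eps"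
              using elim by (simp add: dist_norm)
          qed
        qed
      qed
      ultimately show "\<exists>d>0. cball x d \<subseteq> ball b e \<and>
          uniform_limit (cball x d) (\<lambda>n b'. (f (a + h n, b') - f (a, b')) / h n)
          (\<lambda>b'. partial_a f (a, b')) sequentially" by blast
    qed auto
    then have 2: "(\<lambda>b'. partial_a f (a, b')) field_differentiable (at b)"
      using e(1) by (auto intro: holomorphic_on_imp_differentiable_at)
    show ?thesis
      using 1 2 3 e(1) half_gt_zero by blast
  qed
  then show ?thesis
    unfolding bounded_holomorphic2_on_def holomorphic2_on_def by fastforce
qed

lemma bounded_holomorphic2_on_swap:
  assumes "bounded_holomorphic2_on f G"
  shows "bounded_holomorphic2_on (f \<circ> prod.swap) (prod.swap ` G)"
proof -
  have "\<exists>e>0. \<exists>M. \<forall>a'\<in>cball a e. \<forall>b'\<in>cball b e. (a', b') \<in> prod.swap ` G \<and>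
      norm ((f \<circ> prod.swap) (a', b')) \<le> M" if ba: "(b, a) \<in> G" for a b
  proof -
    obtain e M where e: "e > 0" "M \<ge> 0" "cball b e \<times> cball a e \<subseteq> G"
      "\<forall>a'\<in>cball b e. \<forall>b'\<in>cball a e. norm (f (a', b')) \<le> M"
      by (rule bounded_holomorphic2_onE[OF assms ba])
    have "\<forall>a'\<in>cball a e. \<forall>b'\<in>cball b e. (a', b') \<in> prod.swap ` G \<and>
        norm ((f \<circ> prod.swap) (a', b')) \<le> M"
      using e(3,4) by auto
    then show ?thesis using e(1) by blast
  qed
  moreover have "holomorphic2_on (f \<circ> prod.swap) (prod.swap ` G)"
    using assms unfolding bounded_holomorphic2_on_def holomorphic2_on_def by auto
  ultimately show ?thesis
    unfolding bounded_holomorphic2_on_def by (simp add: split_beta image_iff) 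
qed

lemma bounded_holomorphic2_on_partial_b:
  assumes "bounded_holomorphic2_on f G"
  shows "bounded_holomorphic2_on (partial_b f) G"
proof -
  have eq: "partial_b f = partial_a (f \<circ> prod.swap) \<circ> prod.swap"
    by (auto simp: partial_a_def partial_b_def fun_eq_iff)
  have "bounded_holomorphic2_on (partial_a (f \<circ> prod.swap) \<circ> prod.swap) (prod.swap ` prod.swap ` G)"
    by (intro bounded_holomorphic2_on_swap bounded_holomorphic2_on_partial_a assms)
  then show ?thesis by (simp add: eq image_comp)
qed

section \<open>Local boundedness of separately holomorphic functions\<close>

lemma funpow_partial_a:
  "(\<lambda>a. (partial_a ^^ n) f (a, b)) = (deriv ^^ n) (\<lambda>a. f (a, b))"
  by (induction n) (simp_all add: partial_a_def)

lemma bounded_holomorphic2_on_funpow_partial_a: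
  "bounded_holomorphic2_on f G \<Longrightarrow> bounded_holomorphic2_on ((partial_a ^^ n) f) G"
  by (induction n) (simp_all add: bounded_holomorphic2_on_partial_a)

text \<open>Otherwise each \<open>cball x r - E n\<close> is relatively open and dense in
  \<open>cball x r\<close>, and by Baire so is dense their intersection, which the covering makes
  empty. Density is checked on the open ball, where interiors may be taken in the whole space, and
  then passes to the closure.\<close>

lemma baire_interior:
  fixes E :: "nat \<Rightarrow> 'a::{real_normed_vector, heine_borel} set"
  assumes "r > 0" "\<And>n. closed (E n)" "cball x r \<subseteq> (\<Union>n. E n)"
  shows "\<exists>n. interior (E n) \<inter> ball x r \<noteq> {}"
proof (rule ccontr)
  assume "\<not> (\<exists>n. interior (E n) \<inter> ball x r \<noteq> {})"
  then have none: "interior (E n) \<inter> ball x r = {}" for n by blast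
  have "cball x r \<subseteq> closure (\<Inter>n. cball x r - E n)"
  proof (rule Baire)
    fix T assume "T \<in> range (\<lambda>n. cball x r - E n)"
    then obtain n where T: "T = cball x r - E n" by blast
    have "openin (top_of_set (cball x r)) T"
      unfolding T using assms(2)[of n] by (simp add: Diff_eq openin_open_Int open_Compl)
    moreover have "ball x r \<subseteq> closure (ball x r \<inter> - E n)"
      using open_Int_closure_subset[of "ball x r" "- E n"] none[of n]
      by (auto simp: closure_complement)
    then have "ball x r \<subseteq> closure T"
      using closure_mono[of "ball x r \<inter> - E n" T] by (fastforce simp: T)
    then have "cball x r \<subseteq> closure T"
      using closure_minimal[of "ball x r" "closure T"] assms(1) by simp
    ultimately show "openin (top_of_set (cball x r)) T \<and> cball x r \<subseteq> closure T" ..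
  qed auto
  moreover have "(\<Inter>n. cball x r - E n) = {}" using assms(3) by auto
  ultimately have "cball x r \<subseteq> closure {}" by (simp only:)
  then show False using assms(1) by simp
qed

text \<open>By Baire the function is bounded on a thin polydisc that is full in the second variable;
  its Taylor coefficients in the first variable are then holomorphic in the second one, and the
  Hartogs lemma upgrades their pointwise growth to a uniform one.\<close>

lemma hartogs_locally_bounded:
  assumes G: "open G" and hol: "holomorphic2_on f G" and ab0: "(a0, b0) \<in> G"
  shows "\<exists>e>0. \<exists>M. \<forall>a\<in>cball a0 e. \<forall>b\<in>cball b0 e. (a, b) \<in> G \<and> norm (f (a, b)) \<le> M"
proof -
  obtain r0 where r0: "r0 > 0" "cball a0 r0 \<times> cball b0 r0 \<subseteq> G" using box_in_open[OF G ab0] .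
  \<comment> \<open>Room for a change of centre: \<open>a1\<close> will lie within \<open>r\<close>
    of \<open>a0\<close>, and the disc of radius \<open>2 * r\<close> about it must stay in the
    domain.\<close>
  define r where "r = r0 / 4"
  have r: "r > 0" "4 * r = r0" using r0(1) by (simp_all add: r_def)
  have box: "cball a0 (4 * r) \<times> cball b0 (4 * r) \<subseteq> G" using r0 r by simp
  have hola: "(\<lambda>a. f (a, b)) holomorphic_on cball a0 (4 * r)" if "b \<in> cball b0 (4 * r)" for b
    by (rule holomorphic2_on_slice[OF hol]) (use that box in auto)
  have holb: "(\<lambda>b. f (a, b)) holomorphic_on cball b0 (4 * r)" if "a \<in> cball a0 (4 * r)" for a
    by (rule holomorphic2_on_slice[OF hol]) (use that box in auto)
  \<comment> \<open>These sets are closed by continuity in \<open>a\<close> for each fixed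
    \<open>b\<close>, and cover the disc by continuity in \<open>b\<close> for each fixed
    \<open>a\<close>.\<close>
  define E where "E n = {a \<in> cball a0 r. \<forall>b\<in>cball b0 r. norm (f (a, b)) \<le> real n}" for n
  have "closed (E n)" for n
  proof -
    have "closed (cball a0 r \<inter> (\<lambda>a. f (a, b)) -` cball 0 (real n))" if "b \<in> cball b0 r" for b
    proof (rule continuous_closed_preimage)
      have "b \<in> cball b0 (4 * r)" using that r by auto
      then have "continuous_on (cball a0 (4 * r)) (\<lambda>a. f (a, b))"
        by (intro holomorphic_on_imp_continuous_on hola)
      then show "continuous_on (cball a0 r) (\<lambda>a. f (a, b))"
        by (rule continuous_on_subset) (use r in auto)
    qed auto
    then have "closed (\<Inter>b\<in>cball b0 r. cball a0 r \<inter> (\<lambda>a. f (a, b)) -` cball 0 (real n))"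
      by (intro closed_INT ballI)
    also have "(\<Inter>b\<in>cball b0 r. cball a0 r \<inter> (\<lambda>a. f (a, b)) -` cball 0 (real n)) = E n"
    proof -
      have "b0 \<in> cball b0 r" using r by simp
      then show ?thesis unfolding E_def by fastforce
    qed
    finally show ?thesis .
  qed
  moreover have "cball a0 r \<subseteq> (\<Union>n. E n)"
  proof
    fix a assume a: "a \<in> cball a0 r"
    then have "a \<in> cball a0 (4 * r)" using r by auto
    then have "continuous_on (cball b0 (4 * r)) (\<lambda>b. f (a, b))"
      by (intro holomorphic_on_imp_continuous_on holb)
    then have "continuous_on (cball b0 r) (\<lambda>b. f (a, b))"
      by (rule continuous_on_subset) (use r in auto)
    then have "bounded ((\<lambda>b. f (a, b)) ` cball b0 r)"
      by (intro compact_imp_bounded compact_continuous_image) auto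
    then obtain B where B: "\<forall>b\<in>cball b0 r. norm (f (a, b)) \<le> B"
      unfolding bounded_iff by blast
    obtain n where "B \<le> real n" using real_arch_simple by blast
    then have "a \<in> E n" using B a unfolding E_def by (blast intro: order_trans)
    then show "a \<in> (\<Union>n. E n)" by blast
  qed
  ultimately obtain m a1 where a1: "a1 \<in> interior (E m)" "a1 \<in> ball a0 r"
    using baire_interior[OF r(1), of E a0] by blast
  obtain eps where eps: "eps > 0" "cball a1 eps \<subseteq> E m" using a1(1) unfolding mem_interior_cball by blast
  have fm: "norm (f (a, b)) \<le> m" if "a \<in> cball a1 eps" "b \<in> cball b0 r" for a b
    using that eps(2) unfolding E_def by blast
  define H where "H = ball a1 eps \<times> ball b0 r"
  have HG: "H \<subseteq> G"
  proof -
    have "E m \<subseteq> cball a0 (4 * r)" using r unfolding E_def by auto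
    then have "ball a1 eps \<subseteq> cball a0 (4 * r)" using eps(2) ball_subset_cball by blast
    moreover have "ball b0 r \<subseteq> cball b0 (4 * r)" using r by auto
    ultimately show ?thesis using box unfolding H_def by blast
  qed
  have "bounded_holomorphic2_on f H"
    unfolding bounded_holomorphic2_on_def
  proof (intro conjI)
    show "holomorphic2_on f H" using hol HG unfolding holomorphic2_on_def by blast
    have "\<exists>e>0. \<exists>M. \<forall>a'\<in>cball a e. \<forall>b'\<in>cball b e. (a', b') \<in> H \<and> norm (f (a', b')) \<le> M"
      if "(a, b) \<in> H" for a b
    proof -
      obtain e where e: "e > 0" "cball a e \<times> cball b e \<subseteq> H"
        using box_in_open[OF _ \<open>(a, b) \<in> H\<close>] unfolding H_def by (metis open_Times open_ball)
      then have "\<forall>a'\<in>cball a e. \<forall>b'\<in>cball b e. (a', b') \<in> H \<and> norm (f (a', b')) \<le> m"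
        using fm unfolding H_def by (auto simp: subset_iff less_imp_le)
      then show ?thesis using e(1) by blast
    qed
    then show "\<forall>(a, b)\<in>H. \<exists>e>0. \<exists>M. \<forall>a'\<in>cball a e. \<forall>b'\<in>cball b e. (a', b') \<in> H \<and> norm (f (a', b')) \<le> M"
      by blast
  qed
  then have bh: "bounded_holomorphic2_on ((partial_a ^^ n) f) H" for n
    by (rule bounded_holomorphic2_on_funpow_partial_a)
  \<comment> \<open>Taylor coefficients about \<open>a1\<close> up to the factorial. On the thin
    polydisc they are iterated partial derivatives of a locally bounded function, hence holomorphic
    in \<open>b\<close>.\<close>
  define D where "D n b = (deriv ^^ n) (\<lambda>a. f (a, b)) a1" for n b
  have D_eq: "D n b = (partial_a ^^ n) f (a1, b)" for n b
    unfolding D_def funpow_partial_a[symmetric] ..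
  have holD: "D n holomorphic_on ball b0 r" for n
    unfolding D_eq[abs_def] using bh[of n] eps(1)
    by (intro holomorphic2_on_slice) (auto simp: bounded_holomorphic2_on_def H_def)
  have bD: "norm (D n b) \<le> fact n * real m / eps ^ n" if "b \<in> ball b0 r" for n b
    unfolding D_def
  proof (rule Cauchy_inequality)
    have sub: "cball a1 eps \<subseteq> cball a0 (4 * r)" using eps(2) r unfolding E_def by auto
    have "b \<in> cball b0 (4 * r)" using that r by auto
    then have "(\<lambda>a. f (a, b)) holomorphic_on cball a1 eps"
      using hola sub holomorphic_on_subset by blast
    then show "(\<lambda>a. f (a, b)) holomorphic_on ball a1 eps" "continuous_on (cball a1 eps) (\<lambda>a. f (a, b))"
      using ball_subset_cball holomorphic_on_imp_continuous_on holomorphic_on_subset by blast+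
    show "norm (f (x, b)) \<le> m" if "norm (a1 - x) = eps" for x
      using fm[of x b] that \<open>b \<in> ball b0 r\<close> by (simp add: dist_norm)
  qed (fact eps(1))
  have sub2: "cball a1 (2 * r) \<subseteq> cball a0 (4 * r)"
  proof
    fix w assume "w \<in> cball a1 (2 * r)"
    then show "w \<in> cball a0 (4 * r)" using a1(2) dist_triangle[of a0 w a1] r by simp
  qed
  have hol2: "(\<lambda>a. f (a, b)) holomorphic_on cball a1 (2 * r)" if "b \<in> cball b0 (4 * r)" for b
    using hola[OF that] sub2 holomorphic_on_subset by blast
  \<comment> \<open>Rescaled so that \<open>w\<close> runs over the unit disc and the Cauchy
    estimate on the disc of radius \<open>2 * r\<close> says that \<open>g n w\<close> is bounded in
    \<open>n\<close>. The factor \<open>r/2\<close> keeps the closed unit disc inside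
    \<open>ball b0 r\<close>, where \<open>D n\<close> is known to be holomorphic.\<close>
  define g where "g n w = D n (b0 + of_real (r/2) * w) / fact n * of_real (2 * r) ^ n" for n w
  have inb: "b0 + of_real (r/2) * w \<in> ball b0 r" if "norm w \<le> 1" for w :: complex
  proof -
    have "r / 2 * norm w \<le> r / 2 * 1" using that r by (intro mult_left_mono) auto
    then have "r / 2 * norm w < r" using r by simp
    then show ?thesis using r by (simp add: dist_norm norm_mult)
  qed
  \<comment> \<open>Uniformly in \<open>w\<close> only the thin radius \<open>eps\<close> is
    available, which costs the ratio \<open>2 * r / eps\<close> at each order; \<open>real m\<close>
    is absorbed by the extra factor of \<open>K ^ Suc n\<close>.\<close>
  define K where "K = max (real m) (2 * r / eps)"
  have K0: "K \<ge> 0" by (simp add: K_def le_max_iff_disj)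
  have gK: "norm (g n w) \<le> K ^ Suc n" if "norm w \<le> 1" for n w
  proof -
    from bD[OF inb[OF that], of n]
    have "norm (D n (b0 + of_real (r/2) * w)) / fact n * (2 * r) ^ n
        \<le> (fact n * real m / eps ^ n) / fact n * (2 * r) ^ n"
      using r by (intro mult_right_mono divide_right_mono) auto
    then have "norm (g n w) \<le> (fact n * real m / eps ^ n) / fact n * (2 * r) ^ n"
      unfolding g_def using r by (simp only: norm_mult norm_divide norm_power norm_of_real norm_fact)
    also have "\<dots> = m * (2 * r / eps) ^ n" by (simp add: power_divide)
    also have "\<dots> \<le> K * K ^ n"
      using r eps K0 by (intro mult_mono power_mono) (auto simp: K_def)
    finally show "norm (g n w) \<le> K ^ Suc n" by simp
  qed
  \<comment> \<open>The rate 6/5 is chosen against the ratio 5/8 at the evaluation points below: the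
    product 3/4 gives a convergent geometric series.\<close>
  have "\<forall>\<^sub>F n in sequentially. \<forall>w. norm w \<le> 1/2 \<longrightarrow> norm (g n w) \<le> (6/5) ^ Suc n"
  proof (rule hartogs_lemma)
    fix n
    have "(D n \<circ> (\<lambda>w. b0 + of_real (r/2) * w)) holomorphic_on cball 0 1"
      by (intro holomorphic_on_compose_gen[OF _ holD] holomorphic_intros) (use inb in auto)
    then have "g n holomorphic_on cball 0 1"
      unfolding g_def o_def by (intro holomorphic_intros) auto
    then show "g n holomorphic_on ball 0 1" "continuous_on (cball 0 1) (g n)"
      using ball_subset_cball holomorphic_on_imp_continuous_on holomorphic_on_subset by blast+
  next
    show "norm (g n w) \<le> K ^ Suc n" if "norm w \<le> 1" for n w using gK[OF that] .
  next
    fix w :: complex assume w: "norm w = 1"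
    define b where "b = b0 + of_real (r/2) * w"
    have b: "b \<in> cball b0 (4 * r)" using inb[of w] w r by (simp add: b_def)
    have "bounded ((\<lambda>a. f (a, b)) ` cball a1 (2 * r))"
      by (intro compact_imp_bounded compact_continuous_image holomorphic_on_imp_continuous_on hol2 b) auto
    then obtain B where B: "\<forall>a\<in>cball a1 (2 * r). norm (f (a, b)) \<le> B" unfolding bounded_iff by blast
    \<comment> \<open>With \<open>b\<close> fixed, \<open>f\<close> is bounded on the whole disc of
      radius \<open>2 * r\<close>, and the power in \<open>g\<close> cancels the one in Cauchy's
      inequality: the bound depends on \<open>w\<close> but not on \<open>n\<close>.\<close>
    have "norm (g n w) \<le> B" for n
    proof -
      have "norm (D n b) \<le> fact n * B / (2 * r) ^ n"
        unfolding D_def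
      proof (rule Cauchy_inequality)
        show "(\<lambda>a. f (a, b)) holomorphic_on ball a1 (2 * r)"
          "continuous_on (cball a1 (2 * r)) (\<lambda>a. f (a, b))"
          using hol2[OF b] ball_subset_cball holomorphic_on_imp_continuous_on holomorphic_on_subset
          by blast+
      qed (use r B in \<open>auto simp: dist_norm\<close>)
      then have "norm (D n b) / fact n * (2 * r) ^ n \<le> (fact n * B / (2 * r) ^ n) / fact n * (2 * r) ^ n"
        using r by (intro mult_right_mono divide_right_mono) auto
      then show ?thesis
        using r unfolding g_def b_def[symmetric] by (simp add: norm_mult norm_divide norm_power)
    qed
    then show "\<exists>B. \<forall>n. norm (g n w) \<le> B" by blast
  qed simp
  then obtain N where N: "\<And>n w. n \<ge> N \<Longrightarrow> norm w \<le> 1/2 \<Longrightarrow> norm (g n w) \<le> (6/5) ^ Suc n"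
    unfolding eventually_sequentially by blast
  \<comment> \<open>The finitely many early terms use the crude bound, together with
    \<open>norm x \<le> 1\<close>.\<close>
  define c where "c n = (if n < N then K ^ Suc n else (6/5) * (3/4) ^ n)" for n :: nat
  have "summable (\<lambda>n. (6/5) * (3/4) ^ n :: real)" by (intro summable_mult summable_geometric) auto
  then have "summable c"
    by (rule summable_cong[THEN iffD1, rotated])
       (auto simp: c_def eventually_sequentially intro!: exI[of _ N])
  have "norm (f (a, b)) \<le> suminf c" if ab: "a \<in> cball a0 (r/4)" "b \<in> cball b0 (r/4)" for a b
  proof -
    define w where "w = of_real (2 / r) * (b - b0)"
    have "2 / r * norm (b - b0) \<le> 2 / r * (r / 4)"
      using ab(2) r by (intro mult_left_mono) (auto simp: dist_norm norm_minus_commute)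
    moreover have "norm w = 2 / r * norm (b - b0)"
      unfolding w_def norm_mult norm_of_real using r by (subst abs_of_pos) auto
    ultimately have w: "norm w \<le> 1/2" using r by simp
    have "of_real (r/2) * w = of_real (r/2 * (2 / r)) * (b - b0)"
      unfolding w_def by (simp only: of_real_mult mult.assoc)
    also have "r/2 * (2 / r) = 1" using r by simp
    finally have "of_real (r/2) * w = b - b0" by simp
    then have bw: "b = b0 + of_real (r/2) * w" by (metis add.commute diff_add_cancel)
    have b4: "b \<in> cball b0 (4 * r)" using ab(2) r by auto
    \<comment> \<open>At most \<open>r/4\<close> from \<open>a\<close> to \<open>a0\<close> and
      \<open>r\<close> from \<open>a0\<close> to \<open>a1\<close>; divided by \<open>2 * r\<close>
      this is 5/8.\<close>
    have aa1: "norm (a - a1) \<le> 5/4 * r"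
      using ab(1) a1(2) dist_triangle[of a a1 a0] by (simp add: dist_norm norm_minus_commute)
    define x where "x = (a - a1) / of_real (2 * r)"
    have x: "norm x \<le> 5/8" using aa1 r by (simp add: x_def norm_divide field_simps)
    have "(\<lambda>n. D n b / fact n * (a - a1) ^ n) sums f (a, b)"
      unfolding D_def
      by (rule holomorphic_power_series[where f = "\<lambda>a. f (a, b)" and r = "2 * r"])
         (use hol2[OF b4] aa1 r in \<open>auto simp: dist_norm norm_minus_commute intro: holomorphic_on_subset\<close>)
    moreover have "D n b / fact n * (a - a1) ^ n = g n w * x ^ n" for n
      using r unfolding g_def bw[symmetric] x_def by (simp add: power_divide)
    ultimately have sums: "(\<lambda>n. g n w * x ^ n) sums f (a, b)" by simp
    have "norm (g n w * x ^ n) \<le> c n" for n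
    proof (cases "n < N")
      case True
      have "norm x ^ n \<le> 1" using x by (intro power_le_one) auto
      then have "norm (g n w) * norm x ^ n \<le> K ^ Suc n * 1"
        using gK[of w n] w K0 by (intro mult_mono) auto
      then show ?thesis using True by (simp add: c_def norm_mult norm_power)
    next
      case False
      have "norm x ^ n \<le> (5/8) ^ n" using x by (intro power_mono) auto
      then have "norm (g n w) * norm x ^ n \<le> (6/5) ^ Suc n * (5/8) ^ n"
        using N[of n w] w False by (intro mult_mono) auto
      also have "\<dots> = 6/5 * ((6/5) * (5/8)) ^ n" by (subst power_mult_distrib) simp
      finally show ?thesis using False by (simp add: c_def norm_mult norm_power)
    qed
    then have "norm (suminf (\<lambda>n. g n w * x ^ n)) \<le> suminf c"
      by (rule norm_suminf_le) fact
    then show ?thesis using sums by (simp add: sums_iff)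
  qed
  moreover have "(a, b) \<in> G" if "a \<in> cball a0 (r/4)" "b \<in> cball b0 (r/4)" for a b
    using that box r by (auto simp: subset_iff)
  ultimately have "\<forall>a\<in>cball a0 (r/4). \<forall>b\<in>cball b0 (r/4). (a, b) \<in> G \<and> norm (f (a, b)) \<le> suminf c"
    by blast
  moreover have "r/4 > 0" using r by simp
  ultimately show ?thesis by blast
qed

section \<open>Hartogs' theorem and total differentiability\<close>

theorem hartogs:
  assumes "open G" "holomorphic2_on f G"
  shows "bounded_holomorphic2_on f G"
  using hartogs_locally_bounded[OF assms] assms(2) unfolding bounded_holomorphic2_on_def by auto

text \<open>Partial derivatives combine to a total derivative once one of them is jointly
  continuous. Here it is \<open>partial_b f\<close>, which inherits local boundedness and separate
  holomorphy from \<open>f\<close>.\<close>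

lemma bounded_holomorphic2_on_has_derivative:
  assumes f: "bounded_holomorphic2_on f G" and p: "p \<in> G" and G: "open G"
  shows "(f has_derivative (\<lambda>v. partial_a f p * fst v + partial_b f p * snd v)) (at p)"
proof -
  obtain a b where ab: "p = (a, b)" by (cases p)
  obtain e where e: "e > 0" "cball a e \<times> cball b e \<subseteq> G" using box_in_open[OF G] p ab by blast
  have sub: "ball a e \<times> ball b e \<subseteq> G" using e(2) ball_subset_cball by blast
  have hol: "holomorphic2_on f G" using f by (simp add: bounded_holomorphic2_on_def)
  have pa: "((\<lambda>a. f (a, y)) has_field_derivative partial_a f (x, y)) (at x)"
    and pb: "((\<lambda>b. f (x, b)) has_field_derivative partial_b f (x, y)) (at y)" if "(x, y) \<in> G" for x y
    using hol that unfolding holomorphic2_on_def partial_a_def partial_b_def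
    by (auto dest!: bspec intro: field_differentiable_derivI)
  have "((\<lambda>(x, y). f (x, y)) has_derivative
      (\<lambda>(tx, ty). partial_a f (a, b) * tx + blinfun_apply (blinfun_mult_right (partial_b f (a, b))) ty))
      (at (a, b) within ball a e \<times> ball b e)"
  proof (rule has_derivative_partialsI[where fy = "\<lambda>x y. blinfun_mult_right (partial_b f (x, y))"])
    show "((\<lambda>x. f (x, b)) has_derivative (*) (partial_a f (a, b))) (at a within ball a e)"
      using pa[of a b] p ab by (auto simp: has_field_derivative_def intro: has_derivative_at_withinI)
    show "((\<lambda>y. f (x, y)) has_derivative blinfun_apply (blinfun_mult_right (partial_b f (x, y))))
        (at y within ball b e)" if "x \<in> ball a e" "y \<in> ball b e" for x y
    proof -
      have "(x, y) \<in> G" using that sub by blast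
      from pb[OF this] show ?thesis
        by (auto simp: has_field_derivative_def intro: has_derivative_at_withinI)
    qed
    have "continuous_on G (partial_b f)"
      by (intro bounded_holomorphic2_on_continuous bounded_holomorphic2_on_partial_b f)
    then have "continuous_on (ball a e \<times> ball b e) (partial_b f)"
      using sub by (rule continuous_on_subset)
    then have "continuous_on (ball a e \<times> ball b e) (\<lambda>q. blinfun_mult_right (partial_b f q))"
      by (intro continuous_intros)
    then show "continuous (at (a, b) within ball a e \<times> ball b e)
        (\<lambda>(x, y). blinfun_mult_right (partial_b f (x, y)))"
      using e(1) by (simp add: continuous_on_eq_continuous_within split_beta')
  qed (use e in auto)
  then have "(f has_derivative (\<lambda>v. partial_a f p * fst v + partial_b f p * snd v))
      (at p within ball a e \<times> ball b e)"
    by (simp add: ab split_beta')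
  moreover have "at p within ball a e \<times> ball b e = at p"
    using e(1) by (intro at_within_open) (auto simp: ab intro: open_Times)
  ultimately show ?thesis by simp
qed

lemma vector_derivative_compose2:
  assumes "bounded_holomorphic2_on f G" "open G" "\<gamma> t \<in> G"
    "(\<gamma> has_vector_derivative v) (at t within A)"
  shows "((\<lambda>t. f (\<gamma> t)) has_vector_derivative
    partial_a f (\<gamma> t) * fst v + partial_b f (\<gamma> t) * snd v) (at t within A)"
proof -
  have "((f \<circ> \<gamma>) has_derivative (\<lambda>v. partial_a f (\<gamma> t) * fst v + partial_b f (\<gamma> t) * snd v) \<circ> (\<lambda>h. h *\<^sub>R v))
      (at t within A)"
  proof (rule diff_chain_within)
    show "(\<gamma> has_derivative (\<lambda>h. h *\<^sub>R v)) (at t within A)"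
      using assms(4) by (simp only: has_vector_derivative_def)
    show "(f has_derivative (\<lambda>v. partial_a f (\<gamma> t) * fst v + partial_b f (\<gamma> t) * snd v))
        (at (\<gamma> t) within \<gamma> ` A)"
      by (rule has_derivative_at_withinI[OF bounded_holomorphic2_on_has_derivative[OF assms(1,3,2)]])
  qed
  then show ?thesis
    by (simp add: has_vector_derivative_def o_def scaleR_add_right)
qed

section \<open>Green's formula on the unit square\<close>

text \<open>The inner integral of \<open>f \<partial>g/\<partial>t\<close> is differentiated along the diagonal: in the argument of \<open>f\<close>
  directly, in that of \<open>g\<close> after an integration by parts. So no mixed second derivative of \<open>g\<close>
  is needed.\<close>

lemma green_unit_square:
  fixes f g fs ft gs gt :: "real \<times> real \<Rightarrow> complex"
  assumes fs: "\<And>s t. s \<in> {0..1} \<Longrightarrow> t \<in> {0..1} \<Longrightarrow>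
      ((\<lambda>s. f (s, t)) has_vector_derivative fs (s, t)) (at s within {0..1})"
    and ft: "\<And>s t. s \<in> {0..1} \<Longrightarrow> t \<in> {0..1} \<Longrightarrow>
      ((\<lambda>t. f (s, t)) has_vector_derivative ft (s, t)) (at t within {0..1})"
    and gs: "\<And>s t. s \<in> {0..1} \<Longrightarrow> t \<in> {0..1} \<Longrightarrow>
      ((\<lambda>s. g (s, t)) has_vector_derivative gs (s, t)) (at s within {0..1})"
    and gt: "\<And>s t. s \<in> {0..1} \<Longrightarrow> t \<in> {0..1} \<Longrightarrow>
      ((\<lambda>t. g (s, t)) has_vector_derivative gt (s, t)) (at t within {0..1})"
    and cont: "continuous_on unit_square f" "continuous_on unit_square g"
      "continuous_on unit_square fs" "continuous_on unit_square ft"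
      "continuous_on unit_square gs" "continuous_on unit_square gt"
  shows "integral unit_square (\<lambda>q. fs q * gt q - ft q * gs q) =
    integral {0..1} (\<lambda>s. f (s, 0) * gs (s, 0)) + integral {0..1} (\<lambda>t. f (1, t) * gt (1, t))
    - integral {0..1} (\<lambda>s. f (s, 1) * gs (s, 1)) - integral {0..1} (\<lambda>t. f (0, t) * gt (0, t))"
proof -
  have c1: "continuous_on A (\<lambda>x. h (u x, v x))"
    if "continuous_on unit_square h" "continuous_on A u" "continuous_on A v"
      "\<And>x. x \<in> A \<Longrightarrow> u x \<in> {0..1} \<and> v x \<in> {0..1}"
    for h :: "real \<times> real \<Rightarrow> complex" and A :: "'c::topological_space set" and u v
    by (rule continuous_on_compose2[OF that(1)]) (use that in \<open>auto intro!: continuous_intros\<close>)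
  have cb[simp]: "cbox (0::real) 1 = {0..1}" by simp
  \<comment> \<open>Two independent parameters replace the single outer variable, and the inner
    integral is the value on the diagonal. \<open>k1\<close> and \<open>k2\<close> will be the
    partial derivatives; the boundary terms in \<open>k2\<close> are the future integrals over the
    horizontal sides.\<close>
  define K where "K p = integral {0..1} (\<lambda>t. f (fst p, t) * gt (snd p, t))" for p
  define k1 where "k1 p = integral {0..1} (\<lambda>t. fs (fst p, t) * gt (snd p, t))" for p
  define k2 where "k2 p = f (fst p, 1) * gs (snd p, 1) - f (fst p, 0) * gs (snd p, 0)
      - integral {0..1} (\<lambda>t. ft (fst p, t) * gs (snd p, t))" for p
  have byparts: "integral {0..1} (\<lambda>t. f (r, t) * gt (s, t)) =
      f (r, 1) * g (s, 1) - f (r, 0) * g (s, 0) - integral {0..1} (\<lambda>t. ft (r, t) * g (s, t))"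
    if "r \<in> {0..1}" "s \<in> {0..1}" for r s
  proof -
    have "((\<lambda>t. f (r, t) * gt (s, t) + ft (r, t) * g (s, t)) has_integral
        f (r, 1) * g (s, 1) - f (r, 0) * g (s, 0)) {0..1}"
      by (rule fundamental_theorem_of_calculus)
         (use that in \<open>auto intro!: has_vector_derivative_mult ft gt\<close>)
    then have "integral {0..1} (\<lambda>t. f (r, t) * gt (s, t) + ft (r, t) * g (s, t))
        = f (r, 1) * g (s, 1) - f (r, 0) * g (s, 0)" by (rule integral_unique)
    moreover have "(\<lambda>t. f (r, t) * gt (s, t)) integrable_on {0..1}"
      "(\<lambda>t. ft (r, t) * g (s, t)) integrable_on {0..1}"
      by (intro integrable_continuous_real continuous_on_mult c1 cont continuous_intros; use that in simp)+
    ultimately show ?thesis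
      by (simp add: integral_add eq_diff_eq)
  qed
  have K1: "((\<lambda>r. K (r, s)) has_vector_derivative k1 (r, s)) (at r within {0..1})"
    if "r \<in> {0..1}" "s \<in> {0..1}" for r s
    unfolding K_def k1_def fst_conv snd_conv cb[symmetric]
  proof (rule leibniz_rule_vector_derivative)
    show "((\<lambda>r. f (r, t) * gt (s, t)) has_vector_derivative fs (x, t) * gt (s, t)) (at x within cbox 0 1)"
      if "x \<in> cbox 0 1" "t \<in> cbox 0 1" for x t
      using fs[of x t] that by (auto intro!: has_vector_derivative_mult_left)
    show "(\<lambda>t. f (x, t) * gt (s, t)) integrable_on cbox 0 1" if "x \<in> cbox 0 1" for x
      using that \<open>s \<in> _\<close>
      by (simp, intro integrable_continuous_real continuous_on_mult c1 cont continuous_intros; simp)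
    show "continuous_on (cbox 0 1 \<times> cbox 0 1) (\<lambda>(x, t). fs (x, t) * gt (s, t))"
      using \<open>s \<in> _\<close> unfolding split_beta
      by (intro continuous_on_mult c1 cont continuous_intros; auto)
  qed (use that in auto)
  have K2: "((\<lambda>s. K (r, s)) has_vector_derivative k2 (r, s)) (at s within {0..1})"
    if rs: "r \<in> {0..1}" "s \<in> {0..1}" for r s
  proof -
    have d1: "((\<lambda>s. integral (cbox 0 1) (\<lambda>t. ft (r, t) * g (s, t))) has_vector_derivative
        integral (cbox 0 1) (\<lambda>t. ft (r, t) * gs (s, t))) (at s within {0..1})"
    proof (rule leibniz_rule_vector_derivative)
      show "((\<lambda>s. ft (r, t) * g (s, t)) has_vector_derivative ft (r, t) * gs (x, t)) (at x within {0..1})"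
        if "x \<in> {0..1}" "t \<in> cbox 0 1" for x t
        using gs[of x t] that by (auto intro!: has_vector_derivative_mult_right)
      show "(\<lambda>t. ft (r, t) * g (x, t)) integrable_on cbox 0 1" if "x \<in> {0..1}" for x
        using that rs
        by (simp, intro integrable_continuous_real continuous_on_mult c1 cont continuous_intros; simp)
      show "continuous_on ({0..1} \<times> cbox 0 1) (\<lambda>(x, t). ft (r, t) * gs (x, t))"
        using rs unfolding split_beta
        by (intro continuous_on_mult c1 cont continuous_intros; auto)
    qed (use rs in auto)
    have "((\<lambda>s. f (r, 1) * g (s, 1) - f (r, 0) * g (s, 0)) has_vector_derivative
        f (r, 1) * gs (s, 1) - f (r, 0) * gs (s, 0)) (at s within {0..1})"
      using rs by (intro has_vector_derivative_diff has_vector_derivative_mult_right gs) auto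
    from has_vector_derivative_diff[OF this d1]
    have "((\<lambda>s. f (r, 1) * g (s, 1) - f (r, 0) * g (s, 0)
        - integral {0..1} (\<lambda>t. ft (r, t) * g (s, t))) has_vector_derivative k2 (r, s)) (at s within {0..1})"
      by (simp add: k2_def)
    then show ?thesis
      by (rule has_vector_derivative_transform[rotated 2]) (use rs byparts in \<open>auto simp: K_def\<close>)
  qed
  \<comment> \<open>Continuity of one partial derivative makes \<open>K\<close> totally
    differentiable, so that it may be restricted to the diagonal.\<close>
  have contk2: "continuous_on unit_square k2"
    unfolding k2_def
  proof (intro continuous_on_diff continuous_on_mult c1 cont continuous_intros; (simp; fail)?)
    have "continuous_on unit_square (\<lambda>p. integral (cbox 0 1) (\<lambda>t. ft (fst p, t) * gs (snd p, t)))"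
      by (rule integral_continuous_on_param, unfold split_beta)
         (intro continuous_on_mult c1 cont continuous_intros; auto)
    then show "continuous_on unit_square (\<lambda>p. integral {0..1} (\<lambda>t. ft (fst p, t) * gs (snd p, t)))"
      by simp
  qed auto
  have diag: "((\<lambda>r. K (r, r)) has_vector_derivative k1 (r, r) + k2 (r, r)) (at r within {0..1})"
    if r: "r \<in> {0..1}" for r
  proof -
    have "((\<lambda>(x, y). K (x, y)) has_derivative
        (\<lambda>(tx, ty). tx *\<^sub>R k1 (r, r) + blinfun_apply (blinfun_scaleR_left (k2 (r, r))) ty))
        (at (r, r) within {0..1} \<times> {0..1})"
    proof (rule has_derivative_partialsI[where fy = "\<lambda>x y. blinfun_scaleR_left (k2 (x, y))"])
      show "((\<lambda>x. K (x, r)) has_derivative (\<lambda>tx. tx *\<^sub>R k1 (r, r))) (at r within {0..1})"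
        using K1[OF r r] by (simp add: has_vector_derivative_def)
      show "((\<lambda>y. K (x, y)) has_derivative blinfun_apply (blinfun_scaleR_left (k2 (x, y)))) (at y within {0..1})"
        if "x \<in> {0..1}" "y \<in> {0..1}" for x y
        using K2[OF that] by (simp add: has_vector_derivative_def)
      have "continuous_on unit_square (\<lambda>p. blinfun_scaleR_left (k2 p))"
        by (intro continuous_intros contk2)
      then show "continuous (at (r, r) within {0..1} \<times> {0..1}) (\<lambda>(x, y). blinfun_scaleR_left (k2 (x, y)))"
        using r by (simp add: continuous_on_eq_continuous_within split_beta')
    qed (use r in auto)
    then have "(K has_derivative (\<lambda>(tx, ty). tx *\<^sub>R k1 (r, r) + ty *\<^sub>R k2 (r, r)))
        (at (r, r) within unit_square)"
      by (simp add: split_beta')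
    then have d1: "(K has_derivative (\<lambda>(tx, ty). tx *\<^sub>R k1 (r, r) + ty *\<^sub>R k2 (r, r)))
        (at (r, r) within (\<lambda>r. (r, r)) ` {0..1})"
      by (rule has_derivative_subset) auto
    have d2: "((\<lambda>r. (r, r)) has_derivative (\<lambda>h. (h, h))) (at r within {0..1})"
      by (intro derivative_intros)
    have "((\<lambda>r. K (r, r)) has_derivative (\<lambda>h. h *\<^sub>R k1 (r, r) + h *\<^sub>R k2 (r, r))) (at r within {0..1})"
      using has_derivative_in_compose[OF d2 d1] by simp
    then show ?thesis by (simp add: has_vector_derivative_def scaleR_add_right)
  qed
  \<comment> \<open>The two values of \<open>K\<close> are the integrals over the right and the left
    side.\<close>
  have "((\<lambda>r. k1 (r, r) + k2 (r, r)) has_integral K (1, 1) - K (0, 0)) {0..1}"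
    by (rule fundamental_theorem_of_calculus) (use diag in auto)
  moreover have bot: "(\<lambda>r. f (r, 0) * gs (r, 0)) integrable_on {0..1}"
    and top: "(\<lambda>r. f (r, 1) * gs (r, 1)) integrable_on {0..1}"
    by (intro integrable_continuous_real continuous_on_mult c1 cont continuous_intros; simp)+
  ultimately have "((\<lambda>r. k1 (r, r) + k2 (r, r) - f (r, 1) * gs (r, 1) + f (r, 0) * gs (r, 0)) has_integral
      K (1, 1) - K (0, 0) - integral {0..1} (\<lambda>r. f (r, 1) * gs (r, 1))
      + integral {0..1} (\<lambda>r. f (r, 0) * gs (r, 0))) {0..1}"
    by (intro has_integral_add has_integral_diff integrable_integral)
  moreover have "k1 (r, r) + k2 (r, r) - f (r, 1) * gs (r, 1) + f (r, 0) * gs (r, 0)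
      = integral {0..1} (\<lambda>t. fs (r, t) * gt (r, t) - ft (r, t) * gs (r, t))" if "r \<in> {0..1}" for r
  proof -
    have "(\<lambda>t. fs (r, t) * gt (r, t)) integrable_on {0..1}"
      "(\<lambda>t. ft (r, t) * gs (r, t)) integrable_on {0..1}"
      by (intro integrable_continuous_real continuous_on_mult c1 cont continuous_intros; use that in simp)+
    then show ?thesis by (simp add: k1_def k2_def integral_diff)
  qed
  ultimately have "integral {0..1} (\<lambda>r. integral {0..1} (\<lambda>t. fs (r, t) * gt (r, t) - ft (r, t) * gs (r, t)))
      = K (1, 1) - K (0, 0) - integral {0..1} (\<lambda>r. f (r, 1) * gs (r, 1))
      + integral {0..1} (\<lambda>r. f (r, 0) * gs (r, 0))"
    by (metis (no_types, lifting) has_integral_eq integral_unique)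
  moreover have sq: "unit_square = cbox (0, 0) (1, 1)" by (simp add: cbox_Pair_eq)
  have "continuous_on unit_square (\<lambda>q. fs q * gt q - ft q * gs q)"
    by (intro continuous_intros cont)
  then have "integral unit_square (\<lambda>q. fs q * gt q - ft q * gs q)
      = integral {0..1} (\<lambda>r. integral {0..1} (\<lambda>t. fs (r, t) * gt (r, t) - ft (r, t) * gs (r, t)))"
    unfolding sq by (subst integral_prod_continuous) simp_all
  ultimately show ?thesis by (simp add: K_def)
qed

section \<open>Integrals along arcs and loops\<close>

text \<open>The derivative is carried along as a second function so that it is available, continuous
  and nonzero, up to the ends, where it is one-sided.\<close>

definition regular_arc :: "(real \<Rightarrow> 'a::real_inner) \<Rightarrow> (real \<Rightarrow> 'a) \<Rightarrow> bool" where
  "regular_arc e d \<longleftrightarrow> inj_on e {0..1} \<and> continuous_on {0..1} d \<and>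
     (\<forall>t\<in>{0..1}. (e has_vector_derivative d t) (at t within {0..1}) \<and> d t \<noteq> 0)"

lemma regular_arc_continuous:
  assumes "regular_arc e d" shows "continuous_on {0..1} e"
  unfolding continuous_on_eq_continuous_within
proof
  fix t :: real assume "t \<in> {0..1}"
  then have "(e has_vector_derivative d t) (at t within {0..1})"
    using assms unfolding regular_arc_def by blast
  then show "continuous (at t within {0..1}) e" by (rule has_vector_derivative_continuous)
qed

lemma regular_arc_eq_iff:
  "regular_arc e d \<Longrightarrow> s \<in> {0..1} \<Longrightarrow> t \<in> {0..1} \<Longrightarrow> e s = e t \<longleftrightarrow> s = t"
  unfolding regular_arc_def using inj_on_eq_iff[of e "{0..1}" s t] by blast

text \<open>Caratheodory's form \<open>u z - u (h t) = k z * (z - h t)\<close> recovers the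
  difference quotient of \<open>h\<close> by dividing that of the composition by
  \<open>k (h y)\<close>, which tends to \<open>m \<noteq> 0\<close>. Differentiability of
  \<open>h\<close> is thus a conclusion, also when \<open>h t\<close> is an end of an interval
  \<open>S\<close>.\<close>

lemma has_real_derivative_lift:
  fixes u h :: "real \<Rightarrow> real"
  assumes u: "(u has_field_derivative m) (at (h t) within S)" and "m \<noteq> 0"
    and h: "isCont h t" "\<forall>\<^sub>F y in at t. h y \<in> S"
    and uh: "((\<lambda>y. u (h y)) has_field_derivative v) (at t)"
  shows "(h has_field_derivative v / m) (at t)"
proof -
  obtain k where k: "\<And>z. u z - u (h t) = k z * (z - h t)" "continuous (at (h t) within S) k" "k (h t) = m"
    using u unfolding DERIV_caratheodory_within by blast
  have "((\<lambda>y. k (h y)) \<longlongrightarrow> m) (at t)"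
    using continuous_within_tendsto_compose[OF k(2) h(2)] h(1) k(3) by (simp add: isCont_def)
  moreover from this have ev: "\<forall>\<^sub>F y in at t. k (h y) \<noteq> 0"
    using \<open>m \<noteq> 0\<close> by (rule tendsto_imp_eventually_ne)
  moreover have "((\<lambda>y. (u (h y) - u (h t)) / (y - t)) \<longlongrightarrow> v) (at t)"
    using uh by (simp add: has_field_derivative_iff)
  ultimately have "((\<lambda>y. (u (h y) - u (h t)) / (y - t) / k (h y)) \<longlongrightarrow> v / m) (at t)"
    using \<open>m \<noteq> 0\<close> by (intro tendsto_divide)
  moreover have "\<forall>\<^sub>F y in at t. (u (h y) - u (h t)) / (y - t) / k (h y) = (h y - h t) / (y - t)"
    using ev by eventually_elim (simp add: k(1))
  ultimately have "((\<lambda>y. (h y - h t) / (y - t)) \<longlongrightarrow> v / m) (at t)"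
    by (rule Lim_transform_eventually)
  then show ?thesis by (simp add: has_field_derivative_iff)
qed

text \<open>By compactness the injective continuous \<open>e\<close> has a continuous inverse, so
  \<open>h\<close> is that inverse along \<open>\<gamma>\<close>. To differentiate it,
  \<open>e (h t) = \<gamma> t\<close> is projected onto the tangent \<open>D\<close> of the arc: the
  scalar function \<open>e s \<bullet> D\<close> has the nonzero derivative
  \<open>D \<bullet> D\<close> there, which reduces matters to real functions.\<close>

lemma regular_arc_lift:
  assumes arc: "regular_arc e d" and cont: "continuous_on {\<alpha>..\<beta>} \<gamma>"
    and sub: "\<gamma> ` {\<alpha>..\<beta>} \<subseteq> e ` {0..1}"
  obtains h :: "real \<Rightarrow> real" where "continuous_on {\<alpha>..\<beta>} h"
    "\<And>t. t \<in> {\<alpha>..\<beta>} \<Longrightarrow> h t \<in> {0..1}" "\<And>t. t \<in> {\<alpha>..\<beta>} \<Longrightarrow> e (h t) = \<gamma> t"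
    "\<And>t v. t \<in> {\<alpha><..<\<beta>} \<Longrightarrow> (\<gamma> has_vector_derivative v) (at t) \<Longrightarrow>
       \<exists>\<eta>. (h has_field_derivative \<eta>) (at t) \<and> v = \<eta> *\<^sub>R d (h t)"
proof -
  define h where "h = the_inv_into {0..1} e \<circ> \<gamma>"
  have inj: "inj_on e {0..1}" using arc by (simp add: regular_arc_def)
  have "continuous_on (e ` {0..1}) (the_inv_into {0..1} e)"
    by (rule continuous_on_inv_into[OF regular_arc_continuous[OF arc] compact_Icc inj])
  then have conth: "continuous_on {\<alpha>..\<beta>} h"
    unfolding h_def by (intro continuous_on_compose cont) (rule continuous_on_subset[OF _ sub])
  have h01: "h t \<in> {0..1}" "e (h t) = \<gamma> t" if "t \<in> {\<alpha>..\<beta>}" for t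
  proof -
    have "\<gamma> t \<in> e ` {0..1}" using sub that by blast
    then show "h t \<in> {0..1}" "e (h t) = \<gamma> t"
      unfolding h_def o_def
      using the_inv_into_into[OF inj _ subset_refl] f_the_inv_into_f[OF inj] by blast+
  qed
  have "\<exists>\<eta>. (h has_field_derivative \<eta>) (at t) \<and> v = \<eta> *\<^sub>R d (h t)"
    if t: "t \<in> {\<alpha><..<\<beta>}" and v: "(\<gamma> has_vector_derivative v) (at t)" for t v
  proof -
    have t': "t \<in> {\<alpha>..\<beta>}" using t by auto
    have ev: "\<forall>\<^sub>F y in at t. y \<in> {\<alpha><..<\<beta>}"
      using t by (intro eventually_at_in_open') auto
    define D where "D = d (h t)"
    have D: "D \<noteq> 0" "(e has_vector_derivative D) (at (h t) within {0..1})"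
      using arc h01[OF t'] by (auto simp: regular_arc_def D_def)
    have "((\<lambda>s. e s \<bullet> D) has_field_derivative D \<bullet> D) (at (h t) within {0..1})"
      using bounded_linear.has_vector_derivative[OF bounded_linear_inner_left D(2)]
      by (simp add: has_real_derivative_iff_has_vector_derivative)
    moreover have "D \<bullet> D \<noteq> 0" using D(1) by simp
    moreover have "isCont h t"
      using conth t by (simp add: continuous_on_interior)
    moreover have "\<forall>\<^sub>F y in at t. h y \<in> {0..1}"
      using ev by eventually_elim (use h01 in auto)
    moreover have "((\<lambda>y. e (h y) \<bullet> D) has_field_derivative v \<bullet> D) (at t)"
    proof -
      have "((\<lambda>y. \<gamma> y \<bullet> D) has_field_derivative v \<bullet> D) (at t)"
        using bounded_linear.has_vector_derivative[OF bounded_linear_inner_left v]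
        by (simp add: has_real_derivative_iff_has_vector_derivative)
      then show ?thesis
        by (rule has_field_derivative_transform_within_open[of _ _ _ "{\<alpha><..<\<beta>}"])
           (use t h01 in auto)
    qed
    ultimately have dh: "(h has_field_derivative v \<bullet> D / (D \<bullet> D)) (at t)"
      by (rule has_real_derivative_lift)
    \<comment> \<open>The projection has determined only the multiple; that \<open>v\<close> is
      parallel to \<open>D\<close> follows from the chain rule and the uniqueness of
      derivatives.\<close>
    have "((e \<circ> h) has_vector_derivative (v \<bullet> D / (D \<bullet> D)) *\<^sub>R D) (at t within {\<alpha><..<\<beta>})"
    proof (rule vector_diff_chain_within)
      show "(h has_vector_derivative v \<bullet> D / (D \<bullet> D)) (at t within {\<alpha><..<\<beta>})"
        using dh by (simp add: has_real_derivative_iff_has_vector_derivative has_vector_derivative_at_within)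
      show "(e has_vector_derivative D) (at (h t) within h ` {\<alpha><..<\<beta>})"
        by (rule has_vector_derivative_within_subset[OF D(2)]) (use h01 in auto)
    qed
    then have "((e \<circ> h) has_vector_derivative (v \<bullet> D / (D \<bullet> D)) *\<^sub>R D) (at t)"
      by (simp only: at_within_open[OF t open_greaterThanLessThan])
    then have "(\<gamma> has_vector_derivative (v \<bullet> D / (D \<bullet> D)) *\<^sub>R D) (at t)"
      by (rule has_vector_derivative_transform_within_open[OF _ open_greaterThanLessThan t])
         (simp add: h01)
    then have "v = (v \<bullet> D / (D \<bullet> D)) *\<^sub>R D" using v vector_derivative_unique_at by blast
    then show ?thesis using dh unfolding D_def by blast
  qed
  then show ?thesis using that conth h01 by blast
qed

text \<open>The primitive \<open>F\<close> of the form along the arc, composed with the lift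
  \<open>h\<close>, is a primitive along \<open>\<gamma>\<close> by real linearity of
  \<open>W p\<close>. So only the end parameters count; any back and forth within the arc
  cancels.\<close>

lemma regular_arc_integral:
  fixes W :: "'a::real_inner \<Rightarrow> 'a \<Rightarrow> complex"
  assumes arc: "regular_arc e d" and cont: "continuous_on {\<alpha>..\<beta>} \<gamma>"
    and sub: "\<gamma> ` {\<alpha>..\<beta>} \<subseteq> e ` {0..1}" and "\<alpha> \<le> \<beta>"
    and s: "\<gamma> \<alpha> = e s0" "\<gamma> \<beta> = e s1" "s0 \<in> {0..1}" "s1 \<in> {0..1}"
    and K: "finite K" "\<And>t. t \<in> {\<alpha><..<\<beta>} - K \<Longrightarrow> (\<gamma> has_vector_derivative \<gamma>' t) (at t)"
    and W: "\<And>p. linear (W p)" "continuous_on {0..1} (\<lambda>s. W (e s) (d s))"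
  shows "((\<lambda>t. W (\<gamma> t) (\<gamma>' t)) has_integral
    integral {0..s1} (\<lambda>s. W (e s) (d s)) - integral {0..s0} (\<lambda>s. W (e s) (d s))) {\<alpha>..\<beta>}"
proof -
  obtain h where h: "continuous_on {\<alpha>..\<beta>} h" "\<And>t. t \<in> {\<alpha>..\<beta>} \<Longrightarrow> h t \<in> {0..1}"
    "\<And>t. t \<in> {\<alpha>..\<beta>} \<Longrightarrow> e (h t) = \<gamma> t"
    "\<And>t v. t \<in> {\<alpha><..<\<beta>} \<Longrightarrow> (\<gamma> has_vector_derivative v) (at t) \<Longrightarrow>
       \<exists>\<eta>. (h has_field_derivative \<eta>) (at t) \<and> v = \<eta> *\<^sub>R d (h t)"
    using regular_arc_lift[OF arc cont sub] by blast
  define F where "F u = integral {0..u} (\<lambda>s. W (e s) (d s))" for u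
  have F: "(F has_vector_derivative W (e u) (d u)) (at u within {0..1})" if "u \<in> {0..1}" for u
    unfolding F_def by (rule integral_has_vector_derivative[OF W(2) that])
  have "((\<lambda>t. W (\<gamma> t) (\<gamma>' t)) has_integral F (h \<beta>) - F (h \<alpha>)) {\<alpha>..\<beta>}"
  proof (rule fundamental_theorem_of_calculus_interior_strong[OF K(1) \<open>\<alpha> \<le> \<beta>\<close>])
    have "continuous_on {0..1} F"
      unfolding continuous_on_eq_continuous_within
      by (intro ballI has_vector_derivative_continuous[OF F])
    then show "continuous_on {\<alpha>..\<beta>} (\<lambda>t. F (h t))"
      by (rule continuous_on_compose2[OF _ h(1)]) (use h(2) in blast)
  next
    fix t assume t: "t \<in> {\<alpha><..<\<beta>} - K"
    then obtain \<eta> where \<eta>: "(h has_field_derivative \<eta>) (at t)" "\<gamma>' t = \<eta> *\<^sub>R d (h t)"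
      using h(4) K(2) by blast
    have t': "t \<in> {\<alpha>..\<beta>}" using t by auto
    have "((F \<circ> h) has_vector_derivative \<eta> *\<^sub>R W (e (h t)) (d (h t))) (at t within {\<alpha><..<\<beta>})"
    proof (rule vector_diff_chain_within)
      show "(h has_vector_derivative \<eta>) (at t within {\<alpha><..<\<beta>})"
        using \<eta>(1) by (simp add: has_real_derivative_iff_has_vector_derivative has_vector_derivative_at_within)
      show "(F has_vector_derivative W (e (h t)) (d (h t))) (at (h t) within h ` {\<alpha><..<\<beta>})"
        by (rule has_vector_derivative_within_subset[OF F[OF h(2)[OF t']]]) (use h(2) in auto)
    qed
    then have "((F \<circ> h) has_vector_derivative \<eta> *\<^sub>R W (e (h t)) (d (h t))) (at t)"
      using at_within_open[of t "{\<alpha><..<\<beta>}"] t by (simp only: DiffD1 open_greaterThanLessThan)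
    also have "\<eta> *\<^sub>R W (e (h t)) (d (h t)) = W (\<gamma> t) (\<gamma>' t)"
      unfolding \<eta>(2) h(3)[OF t'] by (rule linear_scale[OF W(1), symmetric])
    finally show "((\<lambda>t. F (h t)) has_vector_derivative W (\<gamma> t) (\<gamma>' t)) (at t)"
      by (simp add: o_def)
  qed
  moreover have "h \<alpha> = s0" "h \<beta> = s1"
    using h(2,3)[of \<alpha>] h(2,3)[of \<beta>] s \<open>\<alpha> \<le> \<beta>\<close> by (auto simp: regular_arc_eq_iff[OF arc])
  ultimately show ?thesis by (simp add: F_def)
qed

lemma simple_closed_eqD:
  assumes "simple_path \<Gamma>" "s \<in> {0..1}" "t \<in> {0..1}" "\<Gamma> s = \<Gamma> t"
  shows "s = t \<or> s = 0 \<and> t = 1 \<or> s = 1 \<and> t = 0"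
  using assms unfolding simple_path_def loop_free_def by blast

text \<open>The parameters of the points inside one of the arcs form an interval \<open>(\<alpha>, \<beta>)\<close>, on which
  the loop runs from one end of the arc to the other.\<close>

lemma loop_integral_over_arc:
  fixes W :: "'a::euclidean_space \<Rightarrow> 'a \<Rightarrow> complex"
  assumes arc: "regular_arc e d"
    and simple: "simple_path \<Gamma>" and closed: "pathfinish \<Gamma> = pathstart \<Gamma>"
    and e_sub: "e ` {0..1} \<subseteq> path_image \<Gamma>"
    and C: "closed C" "path_image \<Gamma> - C = e ` {0<..<1}"
    and base: "\<Gamma> 0 \<notin> e ` {0<..<1}"
    and K: "finite K" "\<And>t. t \<in> {0<..<1} - K \<Longrightarrow> (\<Gamma> has_vector_derivative \<Gamma>' t) (at t)"
    and orient: "\<And>t s. t \<in> {0<..<1} - K \<Longrightarrow> s \<in> {0<..<1} \<Longrightarrow> \<Gamma> t = e s \<Longrightarrow> \<exists>c\<ge>0. \<Gamma>' t = c *\<^sub>R d s"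
    and W: "\<And>p. linear (W p)" "continuous_on {0..1} (\<lambda>s. W (e s) (d s))"
  shows "((\<lambda>t. W (\<Gamma> t) (\<Gamma>' t)) has_integral integral {0..1} (\<lambda>s. W (e s) (d s)))
    {t \<in> {0..1}. \<Gamma> t \<in> e ` {0<..<1}}"
proof -
  define J where "J = {t \<in> {0..1}. \<Gamma> t \<in> e ` {0<..<1}}"
  \<comment> \<open>The complement of \<open>J\<close> in the unit interval. Being closed, it has
    nearest points on either side of a parameter in \<open>J\<close>.\<close>
  define Z where "Z = {0..1} \<inter> \<Gamma> -` C"
  have contG: "continuous_on {0..1} \<Gamma>" using simple by (simp add: simple_path_def path_def)
  have "closed Z" unfolding Z_def by (intro continuous_closed_preimage contG C(1)) auto
  have ZJ: "t \<in> Z \<longleftrightarrow> t \<notin> J" if "t \<in> {0..1}" for t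
  proof -
    have "\<Gamma> t \<in> path_image \<Gamma>" using that by (auto simp: path_image_def)
    then show ?thesis using that C(2) by (auto simp: Z_def J_def)
  qed
  have "\<Gamma> 1 = \<Gamma> 0" using closed by (simp add: pathfinish_def pathstart_def)
  then have "0 \<in> Z" "1 \<in> Z" using base ZJ by (auto simp: J_def)
  have "e (1/2) \<in> \<Gamma> ` {0..1}" using e_sub by (auto simp: path_image_def)
  then obtain t1 where t1: "t1 \<in> {0..1}" "\<Gamma> t1 = e (1/2)" by auto
  then have "t1 \<in> J" by (auto simp: J_def)
  then have "t1 \<notin> Z" using ZJ t1(1) by blast
  have "compact (Z \<inter> {0..t1})" "compact (Z \<inter> {t1..1})"
    using \<open>closed Z\<close> by (auto intro: closed_Int_compact)
  moreover have "0 \<in> Z \<inter> {0..t1}" "1 \<in> Z \<inter> {t1..1}" using \<open>0 \<in> Z\<close> \<open>1 \<in> Z\<close> t1(1) by auto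
  \<comment> \<open>The component of \<open>J\<close> around \<open>t1\<close>: the last parameter
    of \<open>Z\<close> before it and the first one after it.\<close>
  ultimately obtain \<alpha> \<beta> where \<alpha>: "\<alpha> \<in> Z \<inter> {0..t1}" "\<forall>z\<in>Z \<inter> {0..t1}. z \<le> \<alpha>"
    and \<beta>: "\<beta> \<in> Z \<inter> {t1..1}" "\<forall>z\<in>Z \<inter> {t1..1}. \<beta> \<le> z"
    by (metis compact_attains_sup compact_attains_inf empty_iff)
  have ab: "\<alpha> < t1" "t1 < \<beta>" "0 \<le> \<alpha>" "\<beta> \<le> 1"
    using \<alpha>(1) \<beta>(1) \<open>t1 \<notin> Z\<close> by (auto simp: less_le)
  have inJ: "t \<in> J" if "t \<in> {\<alpha><..<\<beta>}" for t
  proof (rule ccontr)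
    assume "t \<notin> J"
    then have "t \<in> Z" using ZJ[of t] that ab by auto
    then show False using \<alpha>(2) \<beta>(2) that ab by (cases "t \<le> t1") force+
  qed
  have contab: "continuous_on {\<alpha>..\<beta>} \<Gamma>" using contG by (rule continuous_on_subset) (use ab in auto)
  have sub: "\<Gamma> ` {\<alpha>..\<beta>} \<subseteq> e ` {0..1}"
  proof -
    have cl: "closure {\<alpha><..<\<beta>} = {\<alpha>..\<beta>}" using ab by simp
    have "closed (e ` {0..1})"
      by (intro compact_imp_closed compact_continuous_image regular_arc_continuous[OF arc]) auto
    moreover have "\<Gamma> ` {\<alpha><..<\<beta>} \<subseteq> e ` {0..1}"
      using inJ by (force simp: J_def)
    ultimately show ?thesis
      using image_closure_subset[of "{\<alpha><..<\<beta>}" \<Gamma> "e ` {0..1}"] contab unfolding cl by blast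
  qed
  obtain h where h: "continuous_on {\<alpha>..\<beta>} h" "\<And>t. t \<in> {\<alpha>..\<beta>} \<Longrightarrow> h t \<in> {0..1}"
    "\<And>t. t \<in> {\<alpha>..\<beta>} \<Longrightarrow> e (h t) = \<Gamma> t"
    "\<And>t v. t \<in> {\<alpha><..<\<beta>} \<Longrightarrow> (\<Gamma> has_vector_derivative v) (at t) \<Longrightarrow>
       \<exists>\<eta>. (h has_field_derivative \<eta>) (at t) \<and> v = \<eta> *\<^sub>R d (h t)"
    using regular_arc_lift[OF arc contab sub] by blast
  have h_end: "h t \<in> {0, 1}" if "t \<in> {\<alpha>..\<beta>}" "t \<in> Z" for t
  proof (rule ccontr)
    assume "h t \<notin> {0, 1}"
    then have "h t \<in> {0<..<1}" using h(2)[OF that(1)] by auto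
    then have "\<Gamma> t \<in> e ` {0<..<1}" using h(3)[OF that(1)] by (metis imageI)
    then have "t \<in> J" using that ab by (auto simp: J_def)
    then show False using ZJ that by (auto simp: J_def)
  qed
  have ends: "h \<alpha> \<in> {0, 1}" "h \<beta> \<in> {0, 1}" using h_end \<alpha>(1) \<beta>(1) ab by auto
  have h_in: "h t \<in> {0<..<1}" if tab: "t \<in> {\<alpha><..<\<beta>}" for t
  proof -
    obtain s where s: "s \<in> {0<..<1}" "\<Gamma> t = e s" using inJ[OF tab] by (auto simp: J_def)
    have "t \<in> {\<alpha>..\<beta>}" using tab by auto
    then have "h t = s" using h(2,3) s regular_arc_eq_iff[OF arc, of "h t" s] by auto
    then show ?thesis using s by simp
  qed
  \<comment> \<open>The tangent of the arc is nonzero, so the sign in the orientation condition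
    passes to the derivative of the lift and, by integration, to its end values.\<close>
  have "h \<alpha> \<le> h \<beta>"
  proof -
    have "\<exists>\<eta>\<ge>0. (h has_field_derivative \<eta>) (at t)" if t: "t \<in> {\<alpha><..<\<beta>} - K" for t
    proof -
      have t01: "t \<in> {0<..<1} - K" using t ab by auto
      obtain \<eta> where \<eta>: "(h has_field_derivative \<eta>) (at t)" "\<Gamma>' t = \<eta> *\<^sub>R d (h t)"
        using h(4) K(2)[OF t01] t by blast
      have "\<Gamma> t = e (h t)" using h(3) t by simp
      then obtain c where c: "c \<ge> 0" "\<Gamma>' t = c *\<^sub>R d (h t)" using orient[OF t01] h_in t by blast
      have "d (h t) \<noteq> 0" using arc h(2)[of t] t by (auto simp: regular_arc_def)
      then have "\<eta> = c" using \<eta>(2) c(2) by simp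
      then show ?thesis using \<eta>(1) c(1) by blast
    qed
    then obtain \<eta> where \<eta>: "\<And>t. t \<in> {\<alpha><..<\<beta>} - K \<Longrightarrow> \<eta> t \<ge> 0 \<and> (h has_field_derivative \<eta> t) (at t)"
      by metis
    define \<eta>0 where "\<eta>0 t = (if t \<in> {\<alpha><..<\<beta>} - K then \<eta> t else 0)" for t
    have int: "(\<eta>0 has_integral h \<beta> - h \<alpha>) {\<alpha>..\<beta>}"
      by (rule fundamental_theorem_of_calculus_interior_strong[OF K(1) _ _ h(1)])
         (use ab \<eta> in \<open>simp_all add: \<eta>0_def flip: has_real_derivative_iff_has_vector_derivative\<close>)
    have "\<eta>0 t \<ge> 0" for t using \<eta> by (auto simp: \<eta>0_def)
    from has_integral_nonneg[OF int this] show ?thesis by simp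
  qed
  \<comment> \<open>Equality would make the interval the whole loop, and both ends of the arc could
    be attained only at the base point, against injectivity of \<open>e\<close>.\<close>
  moreover have "h \<alpha> \<noteq> h \<beta>"
  proof
    assume "h \<alpha> = h \<beta>"
    then have "\<Gamma> \<alpha> = \<Gamma> \<beta>" using h(3)[of \<alpha>] h(3)[of \<beta>] ab by simp
    then have full: "\<alpha> = 0" "\<beta> = 1" using simple_closed_eqD[OF simple, of \<alpha> \<beta>] ab by auto
    have "e s = \<Gamma> 0" if s: "s \<in> {0, 1}" for s
    proof -
      have "e s \<in> \<Gamma> ` {0..1}" using e_sub s by (auto simp: path_image_def)
      then obtain t where t: "t \<in> {0..1}" "\<Gamma> t = e s" by auto
      have "t \<notin> {0<..<1}"
      proof
        assume "t \<in> {0<..<1}"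
        then have "h t \<in> {0<..<1}" "h t \<in> {0..1}" "e (h t) = e s"
          using h_in[of t] h(2,3)[of t] full t by auto
        then show False using regular_arc_eq_iff[OF arc, of "h t" s] s by auto
      qed
      then have "t = 0 \<or> t = 1" using t(1) by auto
      then show ?thesis using t(2) \<open>\<Gamma> 1 = \<Gamma> 0\<close> by auto
    qed
    then have "e 0 = e 1" by simp
    then show False using regular_arc_eq_iff[OF arc, of 0 1] by simp
  qed
  ultimately have hab: "h \<alpha> = 0" "h \<beta> = 1" using ends by auto
  have "J = {\<alpha><..<\<beta>}"
  proof
    show "J \<subseteq> {\<alpha><..<\<beta>}"
    proof
      fix t assume t: "t \<in> J"
      then obtain s where s: "s \<in> {0<..<1}" "\<Gamma> t = e s" "t \<in> {0..1}" by (auto simp: J_def)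
      \<comment> \<open>The lift already covers the arc on this interval, so simplicity of the loop
        leaves no parameter of \<open>J\<close> elsewhere.\<close>
      obtain x where x: "\<alpha> \<le> x" "x \<le> \<beta>" "h x = s"
        using IVT'[of h \<alpha> s \<beta>] hab s(1) h(1) ab by auto
      then have "\<Gamma> t = \<Gamma> x" using s(2) h(3)[of x] by simp
      moreover have "t \<noteq> 0" "t \<noteq> 1" using t ZJ \<open>0 \<in> Z\<close> \<open>1 \<in> Z\<close> by auto
      ultimately have "t = x" using simple_closed_eqD[OF simple s(3), of x] x ab by auto
      moreover have "x \<noteq> \<alpha>" "x \<noteq> \<beta>" using x hab s(1) by auto
      ultimately show "t \<in> {\<alpha><..<\<beta>}" using x by auto
    qed
  qed (use inJ in blast)
  moreover have "((\<lambda>t. W (\<Gamma> t) (\<Gamma>' t)) has_integral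
      integral {0..1} (\<lambda>s. W (e s) (d s)) - integral {0..0} (\<lambda>s. W (e s) (d s))) {\<alpha>..\<beta>}"
  proof (rule regular_arc_integral[OF arc contab sub])
    show "\<Gamma> \<alpha> = e 0" "\<Gamma> \<beta> = e 1" using hab h(3)[of \<alpha>] h(3)[of \<beta>] ab by auto
  qed (use ab K W in auto)
  ultimately show ?thesis unfolding J_def[symmetric] by (simp add: has_integral_Icc_iff_Ioo)
qed

text \<open>The sets \<open>J i\<close> fill the unit interval up to finitely many parameters: what
  is left maps to ends of arcs, and a simple loop takes each value only finitely often. Each
  \<open>J i\<close> contributes the integral over its arc.\<close>

lemma based_loop_integral:
  fixes W :: "'a::euclidean_space \<Rightarrow> 'a \<Rightarrow> complex" and e :: "'i \<Rightarrow> real \<Rightarrow> 'a"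
  assumes I: "finite I" and arc: "\<And>i. i \<in> I \<Longrightarrow> regular_arc (e i) (d i)"
    and disj: "\<And>i j. i \<in> I \<Longrightarrow> j \<in> I \<Longrightarrow> i \<noteq> j \<Longrightarrow> e i ` {0<..<1} \<inter> e j ` {0..1} = {}"
    and simple: "simple_path \<Gamma>" and closed: "pathfinish \<Gamma> = pathstart \<Gamma>"
    and image: "path_image \<Gamma> = (\<Union>i\<in>I. e i ` {0..1})"
    and base: "\<And>i. i \<in> I \<Longrightarrow> \<Gamma> 0 \<notin> e i ` {0<..<1}"
    and K: "finite K" "\<And>t. t \<in> {0<..<1} - K \<Longrightarrow> (\<Gamma> has_vector_derivative \<Gamma>' t) (at t)"
    and orient: "\<And>i t s. i \<in> I \<Longrightarrow> t \<in> {0<..<1} - K \<Longrightarrow> s \<in> {0<..<1} \<Longrightarrow> \<Gamma> t = e i s \<Longrightarrow>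
      \<exists>c\<ge>0. \<Gamma>' t = c *\<^sub>R d i s"
    and W: "\<And>p. linear (W p)" "\<And>i. i \<in> I \<Longrightarrow> continuous_on {0..1} (\<lambda>s. W (e i s) (d i s))"
  shows "((\<lambda>t. W (\<Gamma> t) (\<Gamma>' t)) has_integral (\<Sum>i\<in>I. integral {0..1} (\<lambda>s. W (e i s) (d i s)))) {0..1}"
proof -
  define J where "J i = {t \<in> {0..1}. \<Gamma> t \<in> e i ` {0<..<1}}" for i
  have icc: "{0..1} = insert 0 (insert 1 {0<..<1::real})" by auto
  have J: "((\<lambda>t. W (\<Gamma> t) (\<Gamma>' t)) has_integral integral {0..1} (\<lambda>s. W (e i s) (d i s))) (J i)"
    if i: "i \<in> I" for i
    unfolding J_def
  proof (rule loop_integral_over_arc[OF arc[OF i] simple closed])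
    define C where "C = (\<Union>j\<in>I - {i}. e j ` {0..1}) \<union> {e i 0, e i 1}"
    show "closed C"
      unfolding C_def using I arc
      by (intro closed_Un closed_UN ballI compact_imp_closed[OF compact_continuous_image])
         (auto intro: regular_arc_continuous)
    have "e i 0 \<notin> e i ` {0<..<1}" "e i 1 \<notin> e i ` {0<..<1}"
      using regular_arc_eq_iff[OF arc[OF i]] by auto
    moreover have "e i ` {0<..<1} \<inter> (\<Union>j\<in>I - {i}. e j ` {0..1}) = {}"
    proof (rule equals0I)
      fix x assume x: "x \<in> e i ` {0<..<1} \<inter> (\<Union>j\<in>I - {i}. e j ` {0..1})"
      then obtain j where "j \<in> I" "i \<noteq> j" "x \<in> e j ` {0..1}" by blast
      with disj[OF i, of j] x show False by blast
    qed
    ultimately have "e i ` {0<..<1} \<inter> C = {}" unfolding C_def Int_Un_distrib by simp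
    moreover have "e i ` {0..1} = e i ` {0<..<1} \<union> {e i 0, e i 1}" unfolding icc by auto
    then have "path_image \<Gamma> = e i ` {0<..<1} \<union> C" unfolding image C_def using i by blast
    ultimately show "path_image \<Gamma> - C = e i ` {0<..<1}" by blast
    show "e i ` {0..1} \<subseteq> path_image \<Gamma>" unfolding image using i by (rule UN_upper)
    show "\<Gamma> 0 \<notin> e i ` {0<..<1}" using i by (rule base)
    show "\<exists>c\<ge>0. \<Gamma>' t = c *\<^sub>R d i s"
      if "t \<in> {0<..<1} - K" "s \<in> {0<..<1}" "\<Gamma> t = e i s" for t s
      using i that by (rule orient)
    show "continuous_on {0..1} (\<lambda>s. W (e i s) (d i s))" using i by (rule W(2))
  qed (fact K W(1))+
  have disjJ: "J i \<inter> J j = {}" if "i \<in> I" "j \<in> I" "i \<noteq> j" for i j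
  proof -
    have "e j ` {0<..<1} \<subseteq> e j ` {0..1}" by (intro image_mono) auto
    then show ?thesis using disj[OF that] by (auto simp: J_def)
  qed
  have "((\<lambda>t. W (\<Gamma> t) (\<Gamma>' t)) has_integral (\<Sum>i\<in>I. integral {0..1} (\<lambda>s. W (e i s) (d i s)))) (\<Union>i\<in>I. J i)"
    by (rule has_integral_UN[OF I J]) (auto simp: pairwise_def disjJ)
  moreover have sub: "(\<Union>i\<in>I. J i) \<subseteq> {0..1}" by (auto simp: J_def)
  have fin: "finite ({0..1} - (\<Union>i\<in>I. J i))"
  proof -
    define V where "V = (\<Union>i\<in>I. {e i 0, e i 1})"
    have "inj_on \<Gamma> {0..<1}"
    proof (rule inj_onI)
      fix x y assume "x \<in> {0..<1}" "y \<in> {0..<1}" "\<Gamma> x = \<Gamma> y"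
      then show "x = y" using simple_closed_eqD[OF simple, of x y] by auto
    qed
    moreover have "finite V" using I by (simp add: V_def)
    ultimately have "finite (\<Gamma> -` V \<inter> {0..<1})" by (rule finite_vimage_IntI[rotated])
    moreover have "{0..1} - (\<Union>i\<in>I. J i) \<subseteq> insert 1 (\<Gamma> -` V \<inter> {0..<1})"
    proof
      fix t assume t: "t \<in> {0..1} - (\<Union>i\<in>I. J i)"
      then have "\<Gamma> t \<in> path_image \<Gamma>" by (auto simp: path_image_def)
      then obtain i s where i: "i \<in> I" "s \<in> {0..1}" "\<Gamma> t = e i s" unfolding image by auto
      have "s \<notin> {0<..<1}" using t i by (auto simp: J_def)
      then have "s = 0 \<or> s = 1" using i(2) by auto
      then show "t \<in> insert 1 (\<Gamma> -` V \<inter> {0..<1})" using i t by (auto simp: V_def)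
    qed
    ultimately show ?thesis using finite_subset by blast
  qed
  have "((\<lambda>t. W (\<Gamma> t) (\<Gamma>' t)) has_integral y) (\<Union>i\<in>I. J i) \<longleftrightarrow>
      ((\<lambda>t. W (\<Gamma> t) (\<Gamma>' t)) has_integral y) {0..1}" for y
  proof (rule has_integral_spike_set_eq)
    show "negligible {t \<in> (\<Union>i\<in>I. J i) - {0..1}. W (\<Gamma> t) (\<Gamma>' t) \<noteq> 0}"
      by (rule negligible_subset[OF negligible_empty]) (use sub in blast)
    show "negligible {t \<in> {0..1} - (\<Union>i\<in>I. J i). W (\<Gamma> t) (\<Gamma>' t) \<noteq> 0}"
      by (rule negligible_subset[OF negligible_finite[OF fin]]) blast
  qed
  ultimately show ?thesis by blast
qed

text \<open>If the base point lies inside an arc, the loop is first rotated to a base point at an end of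
  this arc.\<close>

lemma loop_integral:
  fixes W :: "'a::euclidean_space \<Rightarrow> 'a \<Rightarrow> complex" and e :: "'i \<Rightarrow> real \<Rightarrow> 'a"
  assumes I: "finite I" and arc: "\<And>i. i \<in> I \<Longrightarrow> regular_arc (e i) (d i)"
    and disj: "\<And>i j. i \<in> I \<Longrightarrow> j \<in> I \<Longrightarrow> i \<noteq> j \<Longrightarrow> e i ` {0<..<1} \<inter> e j ` {0..1} = {}"
    and simple: "simple_path \<Gamma>" and closed: "pathfinish \<Gamma> = pathstart \<Gamma>"
    and image: "path_image \<Gamma> = (\<Union>i\<in>I. e i ` {0..1})"
    and K: "finite K" "\<And>t. t \<in> {0<..<1} - K \<Longrightarrow> (\<Gamma> has_vector_derivative \<Gamma>' t) (at t)"
    and orient: "\<And>i t s. i \<in> I \<Longrightarrow> t \<in> {0<..<1} - K \<Longrightarrow> s \<in> {0<..<1} \<Longrightarrow> \<Gamma> t = e i s \<Longrightarrow>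
      \<exists>c\<ge>0. \<Gamma>' t = c *\<^sub>R d i s"
    and W: "\<And>p. linear (W p)" "\<And>i. i \<in> I \<Longrightarrow> continuous_on {0..1} (\<lambda>s. W (e i s) (d i s))"
  shows "((\<lambda>t. W (\<Gamma> t) (\<Gamma>' t)) has_integral (\<Sum>i\<in>I. integral {0..1} (\<lambda>s. W (e i s) (d i s)))) {0..1}"
proof -
  define T where "T = (\<Sum>i\<in>I. integral {0..1} (\<lambda>s. W (e i s) (d i s)))"
  have "\<Gamma> 0 \<in> path_image \<Gamma>" by (auto simp: path_image_def)
  then obtain i0 where i0: "i0 \<in> I" unfolding image by auto
  have "e i0 0 \<in> e i0 ` {0..1}" by simp
  then have "e i0 0 \<in> path_image \<Gamma>" unfolding image using i0 by blast
  then obtain a where a: "a \<in> {0..1}" "\<Gamma> a = e i0 0" by (auto simp: path_image_def)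
  \<comment> \<open>An end of an arc lies inside no arc: not its own by injectivity, not another one
    by \<open>disj\<close>.\<close>
  have corner: "\<Gamma> a \<notin> e i ` {0<..<1}" if "i \<in> I" for i
  proof (cases "i = i0")
    case True
    have "e i0 0 \<noteq> e i0 s" if "s \<in> {0<..<1}" for s
      using regular_arc_eq_iff[OF arc[OF i0], of 0 s] that by simp
    then show ?thesis unfolding True a(2) by blast
  next
    case False
    have "e i0 0 \<in> e i0 ` {0..1}" by simp
    then show ?thesis unfolding a(2) using disj[OF that i0 False] by blast
  qed
  define \<Delta> where "\<Delta> = shiftpath a \<Gamma>"
  define \<Delta>' where "\<Delta>' t = (if t < 1 - a then \<Gamma>' (a + t) else \<Gamma>' (a + t - 1))" for t
  \<comment> \<open>The exceptional parameters moved by either branch of the shift, and the junction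
    of the two branches.\<close>
  define L where "L = insert (1 - a) ((\<lambda>t. t - a) ` K \<union> (\<lambda>t. t - a + 1) ` K)"
  have \<Delta>: "\<Delta> t = \<Gamma> (a + t)" if "t < 1 - a" for t using that by (simp add: \<Delta>_def shiftpath_def)
  have \<Delta>2: "\<Delta> t = \<Gamma> (a + t - 1)" if "t > 1 - a" for t using that by (simp add: \<Delta>_def shiftpath_def)
  have in1: "a + t \<in> {0<..<1} - K" if "t \<in> {0<..<1} - L" "t < 1 - a" for t
    using that a(1) by (force simp: L_def image_iff)
  have in2: "a + t - 1 \<in> {0<..<1} - K" if "t \<in> {0<..<1} - L" "t > 1 - a" for t
    using that a(1) by (force simp: L_def image_iff)
  have "((\<lambda>t. W (\<Delta> t) (\<Delta>' t)) has_integral T) {0..1}"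
    unfolding T_def
  proof (rule based_loop_integral[OF I arc disj])
    show "simple_path \<Delta>" unfolding \<Delta>_def using simple closed a by (auto intro: simple_path_shiftpath)
    show "pathfinish \<Delta> = pathstart \<Delta>" unfolding \<Delta>_def by (rule closed_shiftpath[OF closed a(1)])
    show "path_image \<Delta> = (\<Union>i\<in>I. e i ` {0..1})"
      unfolding \<Delta>_def image[symmetric] by (rule path_image_shiftpath[OF a(1) closed])
    have "\<Delta> 0 = \<Gamma> a" using a closed by (auto simp: \<Delta>_def shiftpath_def)
    then show "\<Delta> 0 \<notin> e i ` {0<..<1}" if "i \<in> I" for i using corner[OF that] by simp
    show "finite L" using K(1) by (simp add: L_def)
    show "(\<Delta> has_vector_derivative \<Delta>' t) (at t)" if t: "t \<in> {0<..<1} - L" for t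
    proof (cases "t < 1 - a")
      case True
      have "((\<Gamma> \<circ> (\<lambda>t. a + t)) has_vector_derivative 1 *\<^sub>R \<Gamma>' (a + t)) (at t)"
        by (rule vector_diff_chain_at) (use K(2)[OF in1[OF t True]] in \<open>auto intro!: derivative_eq_intros\<close>)
      then have "((\<lambda>t. \<Gamma> (a + t)) has_vector_derivative \<Delta>' t) (at t)"
        using True by (simp add: o_def \<Delta>'_def)
      then show ?thesis
        by (rule has_vector_derivative_transform_within_open[OF _ open_lessThan])
           (use True in \<open>simp, use \<Delta> in \<open>metis lessThan_iff\<close>\<close>)
    next
      case False
      then have gt: "t > 1 - a" using t by (auto simp: L_def)
      have "((\<Gamma> \<circ> (\<lambda>t. a + t - 1)) has_vector_derivative 1 *\<^sub>R \<Gamma>' (a + t - 1)) (at t)"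
        by (rule vector_diff_chain_at) (use K(2)[OF in2[OF t gt]] in \<open>auto intro!: derivative_eq_intros\<close>)
      then have "((\<lambda>t. \<Gamma> (a + t - 1)) has_vector_derivative \<Delta>' t) (at t)"
        using gt by (simp add: o_def \<Delta>'_def)
      then show ?thesis
        by (rule has_vector_derivative_transform_within_open[OF _ open_greaterThan])
           (use gt in \<open>simp, use \<Delta>2 in \<open>metis greaterThan_iff\<close>\<close>)
    qed
    show "\<exists>c\<ge>0. \<Delta>' t = c *\<^sub>R d i s"
      if "i \<in> I" "t \<in> {0<..<1} - L" "s \<in> {0<..<1}" "\<Delta> t = e i s" for i t s
    proof (cases "t < 1 - a")
      case True
      then show ?thesis using orient[OF that(1) in1[OF that(2) True] that(3)] that(4) \<Delta>
        by (simp add: \<Delta>'_def)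
    next
      case False
      then have gt: "t > 1 - a" using that(2) by (auto simp: L_def)
      then show ?thesis using orient[OF that(1) in2[OF that(2) gt] that(3)] that(4) \<Delta>2
        by (simp add: \<Delta>'_def)
    qed
  qed (use W in auto)
  then have int: "(\<lambda>t. W (\<Delta> t) (\<Delta>' t)) integrable_on {0..1}"
    and eq: "integral {0..1} (\<lambda>t. W (\<Delta> t) (\<Delta>' t)) = T" by (auto simp: has_integral_iff)
  define w where "w t = W (\<Gamma> t) (\<Gamma>' t)" for t
  have i1: "((\<lambda>t. W (\<Delta> t) (\<Delta>' t)) has_integral integral {0..1 - a} (\<lambda>t. W (\<Delta> t) (\<Delta>' t))) {0..1 - a}"
    by (rule integrable_integral[OF integrable_subinterval_real[OF int]]) (use a in auto)
  have i2: "((\<lambda>t. W (\<Delta> t) (\<Delta>' t)) has_integral integral {1 - a..1} (\<lambda>t. W (\<Delta> t) (\<Delta>' t))) {1 - a..1}"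
    by (rule integrable_integral[OF integrable_subinterval_real[OF int]]) (use a in auto)
  \<comment> \<open>The rotation is undone: the first piece of the rotated loop is
    \<open>{a..1}\<close> of the original one, the second is \<open>{0..a}\<close>.\<close>
  have "((w \<circ> (+) a) has_integral integral {0..1 - a} (\<lambda>t. W (\<Delta> t) (\<Delta>' t))) {0..1 - a}"
    by (rule has_integral_spike_finite[OF _ _ i1, of "{1 - a}"]) (auto simp: w_def \<Delta> \<Delta>'_def)
  then have j1: "(w has_integral integral {0..1 - a} (\<lambda>t. W (\<Delta> t) (\<Delta>' t))) {a..1}"
    unfolding has_integral_shift_Icc_real by simp
  have "((w \<circ> (+) (a - 1)) has_integral integral {1 - a..1} (\<lambda>t. W (\<Delta> t) (\<Delta>' t))) {1 - a..1}"
    by (rule has_integral_spike_finite[OF _ _ i2, of "{1 - a}"])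
       (auto simp: w_def \<Delta>2 \<Delta>'_def algebra_simps)
  then have j2: "(w has_integral integral {1 - a..1} (\<lambda>t. W (\<Delta> t) (\<Delta>' t))) {0..a}"
    unfolding has_integral_shift_Icc_real by simp
  have "(w has_integral integral {1 - a..1} (\<lambda>t. W (\<Delta> t) (\<Delta>' t)) + integral {0..1 - a} (\<lambda>t. W (\<Delta> t) (\<Delta>' t))) {0..1}"
    by (rule has_integral_combine[OF _ _ j2 j1]) (use a in auto)
  also have "integral {1 - a..1} (\<lambda>t. W (\<Delta> t) (\<Delta>' t)) + integral {0..1 - a} (\<lambda>t. W (\<Delta> t) (\<Delta>' t)) = T"
    unfolding eq[symmetric] using a
    by (subst add.commute, intro Henstock_Kurzweil_Integration.integral_combine int) auto
  finally show ?thesis unfolding w_def T_def .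
qed

section \<open>Patches and their sides\<close>

lemma smooth_patch_derivatives:
  assumes "smooth_patch \<sigma>" "s \<in> {0..1}" "t \<in> {0..1}"
  shows "((\<lambda>s. \<sigma> (s, t)) has_vector_derivative patch_d1 \<sigma> (s, t)) (at s within {0..1})"
    and "((\<lambda>t. \<sigma> (s, t)) has_vector_derivative patch_d2 \<sigma> (s, t)) (at t within {0..1})"
proof -
  have "(s, t) \<in> unit_square" using assms by simp
  then have "(\<lambda>s. \<sigma> (s, t)) differentiable (at s within {0..1})"
    "(\<lambda>t. \<sigma> (s, t)) differentiable (at t within {0..1})"
    using assms(1) unfolding smooth_patch_def by fastforce+
  then show "((\<lambda>s. \<sigma> (s, t)) has_vector_derivative patch_d1 \<sigma> (s, t)) (at s within {0..1})"
    and "((\<lambda>t. \<sigma> (s, t)) has_vector_derivative patch_d2 \<sigma> (s, t)) (at t within {0..1})"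
    by (simp_all add: patch_d1_def patch_d2_def vector_derivative_works)
qed

lemma smooth_patch_nonzero:
  assumes "smooth_patch \<sigma>" "q \<in> unit_square"
  shows "patch_d1 \<sigma> q \<noteq> 0" "patch_d2 \<sigma> q \<noteq> 0"
proof -
  have ind: "c = 0 \<and> d = 0" if "c *\<^sub>R patch_d1 \<sigma> q + d *\<^sub>R patch_d2 \<sigma> q = 0" for c d
    using assms that unfolding smooth_patch_def by blast
  show "patch_d1 \<sigma> q \<noteq> 0" using ind[of 1 0] by auto
  show "patch_d2 \<sigma> q \<noteq> 0" using ind[of 0 1] by auto
qed

text \<open>The definition gives derivatives along the coordinate lines only; continuity of
  \<open>patch_d2\<close> combines them to a total derivative, and this yields joint
  continuity.\<close>

lemma smooth_patch_continuous:
  assumes "smooth_patch \<sigma>"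
  shows "continuous_on unit_square \<sigma>"
proof -
  have "continuous (at (s, t) within unit_square) \<sigma>" if st: "s \<in> {0..1}" "t \<in> {0..1}" for s t
  proof -
    have "((\<lambda>(s, t). \<sigma> (s, t)) has_derivative
        (\<lambda>(x, y). x *\<^sub>R patch_d1 \<sigma> (s, t) + blinfun_apply (blinfun_scaleR_left (patch_d2 \<sigma> (s, t))) y))
        (at (s, t) within unit_square)"
    proof (rule has_derivative_partialsI[where fy = "\<lambda>s t. blinfun_scaleR_left (patch_d2 \<sigma> (s, t))"])
      show "((\<lambda>s. \<sigma> (s, t)) has_derivative (\<lambda>x. x *\<^sub>R patch_d1 \<sigma> (s, t))) (at s within {0..1})"
        using smooth_patch_derivatives(1)[OF assms st] by (simp add: has_vector_derivative_def)
      show "((\<lambda>t. \<sigma> (x, t)) has_derivative blinfun_apply (blinfun_scaleR_left (patch_d2 \<sigma> (x, y)))) (at y within {0..1})"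
        if "x \<in> {0..1}" "y \<in> {0..1}" for x y
        using smooth_patch_derivatives(2)[OF assms that] by (simp add: has_vector_derivative_def)
      have "continuous_on unit_square (\<lambda>q. blinfun_scaleR_left (patch_d2 \<sigma> q))"
        using assms by (intro continuous_intros) (simp add: smooth_patch_def)
      then show "continuous (at (s, t) within {0..1} \<times> {0..1}) (\<lambda>(x, y). blinfun_scaleR_left (patch_d2 \<sigma> (x, y)))"
        using st by (simp add: continuous_on_eq_continuous_within split_beta')
    qed (use st in auto)
    then show ?thesis using has_derivative_continuous by (fastforce simp: split_beta')
  qed
  then show ?thesis unfolding continuous_on_eq_continuous_within by auto
qed

definition side_deriv :: "patch \<Rightarrow> nat \<Rightarrow> real \<Rightarrow> point" where
  "side_deriv \<sigma> k t =
     [patch_d1 \<sigma> (t, 0), patch_d2 \<sigma> (1, t), - patch_d1 \<sigma> (1 - t, 1), - patch_d2 \<sigma> (0, 1 - t)] ! k"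

lemma less_4_cases: "(k::nat) < 4 \<Longrightarrow> (k = 0 \<Longrightarrow> P) \<Longrightarrow> (k = 1 \<Longrightarrow> P) \<Longrightarrow> (k = 2 \<Longrightarrow> P) \<Longrightarrow> (k = 3 \<Longrightarrow> P) \<Longrightarrow> P"
proof -
  assume "k < 4"
  then have "k = 0 \<or> k = 1 \<or> k = 2 \<or> k = 3" by linarith
  then show "(k = 0 \<Longrightarrow> P) \<Longrightarrow> (k = 1 \<Longrightarrow> P) \<Longrightarrow> (k = 2 \<Longrightarrow> P) \<Longrightarrow> (k = 3 \<Longrightarrow> P) \<Longrightarrow> P" by blast
qed

lemma nth_4: "[a, b, c, d] ! 0 = a" "[a, b, c, d] ! 1 = b" "[a, b, c, d] ! 2 = c" "[a, b, c, d] ! 3 = d"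
  by (simp_all add: numeral_2_eq_2 numeral_3_eq_3)

lemma patch_side_injective:
  assumes "smooth_patch \<sigma>" "k < 4" "l < 4" "s \<in> {0..1}" "t \<in> {0..1}"
    "patch_side \<sigma> k s = patch_side \<sigma> l t"
  shows "[(s, 0), (1, s), (1 - s, 1), (0, 1 - s)] ! k = [(t, 0), (1, t), (1 - t, 1), (0, 1 - t)] ! l"
proof -
  have in_sq: "[(x, 0), (1, x), (1 - x, 1), (0, 1 - x)] ! m \<in> unit_square"
    if "m < 4" "x \<in> {0..1}" for m and x :: real
    using that(1) by (rule less_4_cases) (use that(2) in \<open>simp_all only: nth_4, auto\<close>)
  show ?thesis
    using assms(1,6) in_sq assms(2-5) unfolding smooth_patch_def patch_side_def
    by (meson inj_onD)
qed

text \<open>Only the corners of the square belong to two sides, and injectivity transfers this to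
  the patch.\<close>

lemma patch_side_interior_unique:
  assumes "smooth_patch \<sigma>" "k < 4" "l < 4" "s \<in> {0<..<1}" "t \<in> {0..1}"
    "patch_side \<sigma> k s = patch_side \<sigma> l t"
  shows "k = l"
proof -
  have eq: "[(s, 0), (1, s), (1 - s, 1), (0, 1 - s)] ! k = [(t, 0), (1, t), (1 - t, 1), (0, 1 - t)] ! l"
    using assms by (intro patch_side_injective) auto
  show ?thesis
    by (rule less_4_cases[OF assms(2)]; rule less_4_cases[OF assms(3)])
       (use eq assms(4) in \<open>simp_all only: nth_4, auto\<close>)
qed

lemma patch_side_interior_not_corner:
  assumes "smooth_patch \<sigma>" "k < 4" "s \<in> {0<..<1}"
  shows "patch_side \<sigma> k s \<notin> patch_corners \<sigma>"
proof
  assume "patch_side \<sigma> k s \<in> patch_corners \<sigma>"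
  then obtain q where q: "q \<in> {0, 1} \<times> {0, 1}" "patch_side \<sigma> k s = \<sigma> q"
    unfolding patch_corners_def by blast
  have "[(s, 0), (1, s), (1 - s, 1), (0, 1 - s)] ! k \<in> unit_square"
    by (rule less_4_cases[OF assms(2)]) (use assms(3) in \<open>simp_all only: nth_4, auto\<close>)
  moreover have "q \<in> unit_square" using q(1) by auto
  ultimately have eq: "[(s, 0), (1, s), (1 - s, 1), (0, 1 - s)] ! k = q"
    using q(2) assms(1) unfolding smooth_patch_def patch_side_def by (meson inj_onD)
  show False
    by (rule less_4_cases[OF assms(2)])
       (use eq q(1) assms(3) in \<open>simp_all only: nth_4, auto\<close>)
qed

lemma has_vector_derivative_reflect:
  assumes "(f has_vector_derivative v) (at (1 - t) within {0..1})"
  shows "((\<lambda>t. f (1 - t)) has_vector_derivative - v) (at (t::real) within {0..1})"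
proof -
  have "(\<lambda>t. 1 - t) ` {0..1::real} = {0..1}"
    using image_minus_const_atLeastAtMost'[of 1 0 1] by (simp add: image_diff_atLeastAtMost)
  then have "((f \<circ> (\<lambda>t. 1 - t)) has_vector_derivative (- 1) *\<^sub>R v) (at t within {0..1})"
    by (intro vector_diff_chain_within) (auto intro!: derivative_eq_intros assms)
  then show ?thesis by (simp add: o_def)
qed

lemma regular_arc_side:
  assumes \<sigma>: "smooth_patch \<sigma>" and k: "k < 4"
  shows "regular_arc (patch_side \<sigma> k) (side_deriv \<sigma> k)"
  unfolding regular_arc_def
proof (intro conjI ballI)
  show "inj_on (patch_side \<sigma> k) {0..1}"
  proof (rule inj_onI)
    fix s t :: real assume "s \<in> {0..1}" "t \<in> {0..1}" "patch_side \<sigma> k s = patch_side \<sigma> k t"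
    then have eq: "[(s, 0), (1, s), (1 - s, 1), (0, 1 - s)] ! k = [(t, 0), (1, t), (1 - t, 1), (0, 1 - t)] ! k"
      by (rule patch_side_injective[OF \<sigma> k k])
    show "s = t"
      by (rule less_4_cases[OF k]) (use eq in \<open>simp_all only: nth_4, auto\<close>)
  qed
  have c: "continuous_on {0..1} (\<lambda>t. patch_d1 \<sigma> (u t, v t))" "continuous_on {0..1} (\<lambda>t. patch_d2 \<sigma> (u t, v t))"
    if "continuous_on {0..1} u" "continuous_on {0..1} v" "\<And>t. t \<in> {0..1} \<Longrightarrow> u t \<in> {0..1} \<and> v t \<in> {0..1}"
    for u v :: "real \<Rightarrow> real"
  proof -
    have uv: "continuous_on {0..1} (\<lambda>t. (u t, v t))" by (rule continuous_on_Pair[OF that(1,2)])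
    have sub: "(\<lambda>t. (u t, v t)) ` {0..1} \<subseteq> unit_square"
      by (intro image_subsetI) (simp only: mem_Times_iff fst_conv snd_conv that(3))
    have cd: "continuous_on unit_square (patch_d1 \<sigma>)" "continuous_on unit_square (patch_d2 \<sigma>)"
      using \<sigma> by (simp_all add: smooth_patch_def)
    show "continuous_on {0..1} (\<lambda>t. patch_d1 \<sigma> (u t, v t))"
      "continuous_on {0..1} (\<lambda>t. patch_d2 \<sigma> (u t, v t))"
      by (rule continuous_on_compose2[OF cd(1) uv sub], rule continuous_on_compose2[OF cd(2) uv sub])
  qed
  show "continuous_on {0..1} (side_deriv \<sigma> k)"
    unfolding side_deriv_def
    by (rule less_4_cases[OF k]) (simp_all only: nth_4, auto intro!: c continuous_intros)
  fix t :: real assume t: "t \<in> {0..1}"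
  note d = smooth_patch_derivatives[OF \<sigma>]
  show "(patch_side \<sigma> k has_vector_derivative side_deriv \<sigma> k t) (at t within {0..1})"
    unfolding patch_side_def side_deriv_def
    by (rule less_4_cases[OF k]; simp only: nth_4)
       (use t in \<open>auto intro!: d has_vector_derivative_reflect[where f = "\<lambda>t. \<sigma> (t, 1)"]
          has_vector_derivative_reflect[where f = "\<lambda>t. \<sigma> (0, t)"]\<close>)
  show "side_deriv \<sigma> k t \<noteq> 0"
    unfolding side_deriv_def
    by (rule less_4_cases[OF k]; simp only: nth_4)
       (use t smooth_patch_nonzero[OF \<sigma>] in auto)
qed

section \<open>Line and surface integrals as integrals of complex forms\<close>

definition one_form :: "(point \<Rightarrow> complex) \<Rightarrow> (point \<Rightarrow> complex) \<Rightarrow> point \<Rightarrow> point \<Rightarrow> complex" where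
  "one_form \<phi> \<omega> p v = \<phi> p * fst v + \<omega> p * snd v"

lemma linear_one_form: "linear (one_form \<phi> \<omega> p)"
  unfolding one_form_def by (intro linearI) (simp_all add: algebra_simps)

definition side_integral :: "(point \<Rightarrow> complex) \<Rightarrow> (point \<Rightarrow> complex) \<Rightarrow> patch \<Rightarrow> nat \<Rightarrow> complex" where
  "side_integral \<phi> \<omega> \<sigma> k = integral {0..1} (\<lambda>t. one_form \<phi> \<omega> (patch_side \<sigma> k t) (side_deriv \<sigma> k t))"

text \<open>The pull-back of da db. Its real part is that of dx dz - dy du, its imaginary part that
  of dx du + dy dz.\<close>

definition patch_jacobian :: "patch \<Rightarrow> real \<times> real \<Rightarrow> complex" where
  "patch_jacobian \<sigma> q = fst (patch_d1 \<sigma> q) * snd (patch_d2 \<sigma> q) - fst (patch_d2 \<sigma> q) * snd (patch_d1 \<sigma> q)"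

text \<open>The two real integrands of the definition are the real and imaginary parts of
  \<open>one_form\<close>; existence of the complex integral is assumed so that these parts may be
  taken under the integral sign.\<close>

lemma complex_line_integral_eq:
  assumes "((\<lambda>t. one_form \<phi> \<omega> (\<gamma> t) (vector_derivative \<gamma> (at t within {0..1}))) has_integral I) {0..1}"
  shows "complex_line_integral \<phi> \<omega> \<gamma> = I"
proof -
  have "((\<lambda>t. Re (one_form \<phi> \<omega> (\<gamma> t) (vector_derivative \<gamma> (at t within {0..1})))) has_integral Re I) {0..1}"
    "((\<lambda>t. Im (one_form \<phi> \<omega> (\<gamma> t) (vector_derivative \<gamma> (at t within {0..1})))) has_integral Im I) {0..1}"
    using has_integral_Re[OF assms] has_integral_Im[OF assms] by simp_all
  note this[THEN integral_unique]
  then show ?thesis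
    unfolding complex_line_integral_def real_line_integral_def Let_def
    by (simp add: one_form_def crd_x_def crd_y_def crd_z_def crd_u_def complex_eq_iff algebra_simps)
qed

lemma complex_surface_integral_eq:
  assumes "\<And>\<sigma>. \<sigma> \<in> set S \<Longrightarrow> (\<lambda>q. \<phi> (\<sigma> q) * patch_jacobian \<sigma> q) integrable_on unit_square"
  shows "complex_surface_integral \<phi> S = (\<Sum>\<sigma>\<leftarrow>S. integral unit_square (\<lambda>q. \<phi> (\<sigma> q) * patch_jacobian \<sigma> q))"
  using assms
proof (induction S)
  case Nil
  then show ?case by (simp add: complex_surface_integral_def real_surface_integral_def)
next
  case (Cons \<sigma> S)
  have int: "((\<lambda>q. \<phi> (\<sigma> q) * patch_jacobian \<sigma> q) has_integral
      integral unit_square (\<lambda>q. \<phi> (\<sigma> q) * patch_jacobian \<sigma> q)) unit_square"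
    using Cons.prems by (intro integrable_integral) simp
  note ReIm = has_integral_Re[OF int, THEN integral_unique] has_integral_Im[OF int, THEN integral_unique]
  have "complex_surface_integral \<phi> [\<sigma>] = integral unit_square (\<lambda>q. \<phi> (\<sigma> q) * patch_jacobian \<sigma> q)"
    using ReIm unfolding complex_surface_integral_def real_surface_integral_def Let_def
    by (simp add: area_element_def patch_jacobian_def crd_x_def crd_y_def crd_z_def crd_u_def
        complex_eq_iff algebra_simps)
  moreover have "complex_surface_integral \<phi> (\<sigma> # S)
      = complex_surface_integral \<phi> [\<sigma>] + complex_surface_integral \<phi> S"
    unfolding complex_surface_integral_def real_surface_integral_def Let_def
    by (simp add: complex_eq_iff)
  ultimately show ?case using Cons by simp
qed

lemma integral_reflect_unit:
  fixes f :: "real \<Rightarrow> 'a::banach"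
  assumes "f integrable_on {0..1}"
  shows "integral {0..1} (\<lambda>t. f (1 - t)) = integral {0..1} f"
proof -
  have "(f has_integral integral {0..1} f) (cbox 0 1)"
    using assms by (simp add: integrable_integral)
  from has_integral_affinity[OF this, of "- 1" 1]
  have "((\<lambda>t. f (1 - t)) has_integral integral {0..1} f) ((\<lambda>t. 1 - t) ` {0..1})"
    by (simp add: algebra_simps)
  moreover have "(\<lambda>t. 1 - t) ` {0..1::real} = {0..1}" by (simp add: image_diff_atLeastAtMost)
  ultimately show ?thesis by (simp add: integral_unique)
qed

text \<open>Green's formula is used twice on the parameter square: for \<open>\<phi>1\<close> with
  the first coordinate of the patch and for \<open>\<phi>2\<close> with the second. The boundary
  terms are regrouped by sides; the top and left ones are negative because these sides run against
  the parameter.\<close>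

lemma patch_stokes:
  assumes \<sigma>: "smooth_patch \<sigma>" and sub: "\<sigma> ` unit_square \<subseteq> G" and G: "open G"
    and \<phi>: "bounded_holomorphic2_on \<phi>1 G" "bounded_holomorphic2_on \<phi>2 G"
  shows "(\<lambda>q. (partial_a \<phi>2 (\<sigma> q) - partial_b \<phi>1 (\<sigma> q)) * patch_jacobian \<sigma> q) integrable_on unit_square"
    and "integral unit_square (\<lambda>q. (partial_a \<phi>2 (\<sigma> q) - partial_b \<phi>1 (\<sigma> q)) * patch_jacobian \<sigma> q)
      = (\<Sum>k<4. side_integral \<phi>1 \<phi>2 \<sigma> k)"
proof -
  define D1 where "D1 f q = partial_a f (\<sigma> q) * fst (patch_d1 \<sigma> q) + partial_b f (\<sigma> q) * snd (patch_d1 \<sigma> q)" for f q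
  define D2 where "D2 f q = partial_a f (\<sigma> q) * fst (patch_d2 \<sigma> q) + partial_b f (\<sigma> q) * snd (patch_d2 \<sigma> q)" for f q
  have sq: "unit_square = cbox (0, 0) (1, 1)" by (simp add: cbox_Pair_eq)
  have cont\<sigma>: "continuous_on unit_square \<sigma>" by (rule smooth_patch_continuous[OF \<sigma>])
  have cd: "continuous_on unit_square (patch_d1 \<sigma>)" "continuous_on unit_square (patch_d2 \<sigma>)"
    using \<sigma> by (simp_all add: smooth_patch_def)
  have comp: "continuous_on unit_square (\<lambda>q. f (\<sigma> q))" if "bounded_holomorphic2_on f G" for f
    by (rule continuous_on_compose2[OF bounded_holomorphic2_on_continuous[OF that] cont\<sigma> sub])
  note partials = bounded_holomorphic2_on_partial_a bounded_holomorphic2_on_partial_b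
  have contD: "continuous_on unit_square (D1 f)" "continuous_on unit_square (D2 f)"
    if "bounded_holomorphic2_on f G" for f
    unfolding D1_def D2_def by (intro continuous_intros comp partials that cd)+
  have contJ: "continuous_on unit_square (patch_jacobian \<sigma>)"
    unfolding patch_jacobian_def by (intro continuous_intros cd)
  have in_G: "\<sigma> (s, t) \<in> G" if "s \<in> {0..1}" "t \<in> {0..1}" for s t
    using sub that by auto
  have der: "((\<lambda>s. f (\<sigma> (s, t))) has_vector_derivative D1 f (s, t)) (at s within {0..1})"
    "((\<lambda>t. f (\<sigma> (s, t))) has_vector_derivative D2 f (s, t)) (at t within {0..1})"
    if "bounded_holomorphic2_on f G" "s \<in> {0..1}" "t \<in> {0..1}" for f s t
    unfolding D1_def D2_def
    by (rule vector_derivative_compose2[where \<gamma> = "\<lambda>s. \<sigma> (s, t)", OF that(1) G]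
          vector_derivative_compose2[where \<gamma> = "\<lambda>t. \<sigma> (s, t)", OF that(1) G];
        use in_G that smooth_patch_derivatives[OF \<sigma>] in blast)+
  have green: "integral unit_square (\<lambda>q. D1 f q * L (patch_d2 \<sigma> q) - D2 f q * L (patch_d1 \<sigma> q)) =
      integral {0..1} (\<lambda>s. f (\<sigma> (s, 0)) * L (patch_d1 \<sigma> (s, 0)))
      + integral {0..1} (\<lambda>t. f (\<sigma> (1, t)) * L (patch_d2 \<sigma> (1, t)))
      - integral {0..1} (\<lambda>s. f (\<sigma> (s, 1)) * L (patch_d1 \<sigma> (s, 1)))
      - integral {0..1} (\<lambda>t. f (\<sigma> (0, t)) * L (patch_d2 \<sigma> (0, t)))"
    if f: "bounded_holomorphic2_on f G" and L: "bounded_linear L" for f and L :: "point \<Rightarrow> complex"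
  proof (rule green_unit_square[where f = "\<lambda>q. f (\<sigma> q)" and g = "\<lambda>q. L (\<sigma> q)"])
    show "((\<lambda>s. L (\<sigma> (s, t))) has_vector_derivative L (patch_d1 \<sigma> (s, t))) (at s within {0..1})"
      "((\<lambda>t. L (\<sigma> (s, t))) has_vector_derivative L (patch_d2 \<sigma> (s, t))) (at t within {0..1})"
      if "s \<in> {0..1}" "t \<in> {0..1}" for s t
      by (intro bounded_linear.has_vector_derivative[OF L] smooth_patch_derivatives[OF \<sigma> that])+
    show "continuous_on unit_square (\<lambda>q. L (\<sigma> q))" "continuous_on unit_square (\<lambda>q. L (patch_d1 \<sigma> q))"
      "continuous_on unit_square (\<lambda>q. L (patch_d2 \<sigma> q))"
      by (intro bounded_linear.continuous_on[OF L] cont\<sigma> cd)+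
  qed (use der[OF f] comp[OF f] contD[OF f] in blast)+
  have int1: "(\<lambda>q. D1 f q * L (patch_d2 \<sigma> q) - D2 f q * L (patch_d1 \<sigma> q)) integrable_on unit_square"
    if "bounded_holomorphic2_on f G" "bounded_linear L" for f and L :: "point \<Rightarrow> complex"
    unfolding sq
    by (rule integrable_continuous, fold sq)
       (intro continuous_intros contD that bounded_linear.continuous_on[OF that(2)] cd)
  show "(\<lambda>q. (partial_a \<phi>2 (\<sigma> q) - partial_b \<phi>1 (\<sigma> q)) * patch_jacobian \<sigma> q) integrable_on unit_square"
    unfolding sq
    by (rule integrable_continuous, fold sq) (intro continuous_intros comp partials \<phi> contJ)
  \<comment> \<open>The terms with \<open>partial_a \<phi>1\<close> and
    \<open>partial_b \<phi>2\<close> cancel: the pointwise form of da da = 0 and db db = 0.\<close>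
  have pt: "(partial_a \<phi>2 (\<sigma> q) - partial_b \<phi>1 (\<sigma> q)) * patch_jacobian \<sigma> q =
      (D1 \<phi>1 q * fst (patch_d2 \<sigma> q) - D2 \<phi>1 q * fst (patch_d1 \<sigma> q))
      + (D1 \<phi>2 q * snd (patch_d2 \<sigma> q) - D2 \<phi>2 q * snd (patch_d1 \<sigma> q))" for q
    by (simp add: D1_def D2_def patch_jacobian_def algebra_simps)
  have path_int: "(\<lambda>t. f (\<sigma> (u t, v t)) * L (d (u t, v t))) integrable_on {0..1}"
    if f: "bounded_holomorphic2_on f G" and L: "bounded_linear L"
      and d: "continuous_on unit_square d"
      and uv: "continuous_on {0..1} u" "continuous_on {0..1} v"
      "(\<lambda>t. (u t, v t)) ` {0..1} \<subseteq> unit_square"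
    for f and L :: "point \<Rightarrow> complex" and d :: "real \<times> real \<Rightarrow> point" and u v :: "real \<Rightarrow> real"
  proof (rule integrable_continuous_real)
    have "continuous_on unit_square (\<lambda>q. f (\<sigma> q) * L (d q))"
      by (intro continuous_intros comp[OF f] bounded_linear.continuous_on[OF L] d)
    from continuous_on_compose2[OF this continuous_on_Pair[OF uv(1,2)] uv(3)]
    show "continuous_on {0..1} (\<lambda>t. f (\<sigma> (u t, v t)) * L (d (u t, v t)))" .
  qed
  have bl: "bounded_linear (fst :: point \<Rightarrow> complex)" "bounded_linear (snd :: point \<Rightarrow> complex)"
    by (rule bounded_linear_fst bounded_linear_snd)+
  have e0: "side_integral \<phi>1 \<phi>2 \<sigma> 0 = integral {0..1} (\<lambda>s. \<phi>1 (\<sigma> (s, 0)) * fst (patch_d1 \<sigma> (s, 0)))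
      + integral {0..1} (\<lambda>s. \<phi>2 (\<sigma> (s, 0)) * snd (patch_d1 \<sigma> (s, 0)))"
    unfolding side_integral_def one_form_def patch_side_def side_deriv_def nth_4
    by (intro integral_add path_int[where v = "\<lambda>_. 0"] \<phi> bl cd continuous_intros) auto
  have e1: "side_integral \<phi>1 \<phi>2 \<sigma> 1 = integral {0..1} (\<lambda>t. \<phi>1 (\<sigma> (1, t)) * fst (patch_d2 \<sigma> (1, t)))
      + integral {0..1} (\<lambda>t. \<phi>2 (\<sigma> (1, t)) * snd (patch_d2 \<sigma> (1, t)))"
    unfolding side_integral_def one_form_def patch_side_def side_deriv_def nth_4
    by (intro integral_add path_int[where u = "\<lambda>_. 1"] \<phi> bl cd continuous_intros) auto
  have e2: "side_integral \<phi>1 \<phi>2 \<sigma> 2 = - integral {0..1} (\<lambda>s. \<phi>1 (\<sigma> (s, 1)) * fst (patch_d1 \<sigma> (s, 1)))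
      - integral {0..1} (\<lambda>s. \<phi>2 (\<sigma> (s, 1)) * snd (patch_d1 \<sigma> (s, 1)))"
  proof -
    have i: "(\<lambda>s. \<phi>1 (\<sigma> (s, 1)) * fst (patch_d1 \<sigma> (s, 1))) integrable_on {0..1}"
      "(\<lambda>s. \<phi>2 (\<sigma> (s, 1)) * snd (patch_d1 \<sigma> (s, 1))) integrable_on {0..1}"
      by (intro path_int[where v = "\<lambda>_. 1"] \<phi> bl cd continuous_intros; auto)+
    have "side_integral \<phi>1 \<phi>2 \<sigma> 2 = integral {0..1} (\<lambda>t. - (\<phi>1 (\<sigma> (1 - t, 1)) * fst (patch_d1 \<sigma> (1 - t, 1))
        + \<phi>2 (\<sigma> (1 - t, 1)) * snd (patch_d1 \<sigma> (1 - t, 1))))"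
      unfolding side_integral_def one_form_def patch_side_def side_deriv_def nth_4 by simp
    also have "\<dots> = - integral {0..1} (\<lambda>s. \<phi>1 (\<sigma> (s, 1)) * fst (patch_d1 \<sigma> (s, 1))
        + \<phi>2 (\<sigma> (s, 1)) * snd (patch_d1 \<sigma> (s, 1)))"
      unfolding integral_neg
      by (rule arg_cong[where f = uminus], rule integral_reflect_unit[OF integrable_add[OF i]])
    finally show ?thesis by (simp add: integral_add[OF i])
  qed
  have e3: "side_integral \<phi>1 \<phi>2 \<sigma> 3 = - integral {0..1} (\<lambda>t. \<phi>1 (\<sigma> (0, t)) * fst (patch_d2 \<sigma> (0, t)))
      - integral {0..1} (\<lambda>t. \<phi>2 (\<sigma> (0, t)) * snd (patch_d2 \<sigma> (0, t)))"
  proof -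
    have i: "(\<lambda>t. \<phi>1 (\<sigma> (0, t)) * fst (patch_d2 \<sigma> (0, t))) integrable_on {0..1}"
      "(\<lambda>t. \<phi>2 (\<sigma> (0, t)) * snd (patch_d2 \<sigma> (0, t))) integrable_on {0..1}"
      by (intro path_int[where u = "\<lambda>_. 0"] \<phi> bl cd continuous_intros; auto)+
    have "side_integral \<phi>1 \<phi>2 \<sigma> 3 = integral {0..1} (\<lambda>t. - (\<phi>1 (\<sigma> (0, 1 - t)) * fst (patch_d2 \<sigma> (0, 1 - t))
        + \<phi>2 (\<sigma> (0, 1 - t)) * snd (patch_d2 \<sigma> (0, 1 - t))))"
      unfolding side_integral_def one_form_def patch_side_def side_deriv_def nth_4 by simp
    also have "\<dots> = - integral {0..1} (\<lambda>t. \<phi>1 (\<sigma> (0, t)) * fst (patch_d2 \<sigma> (0, t))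
        + \<phi>2 (\<sigma> (0, t)) * snd (patch_d2 \<sigma> (0, t)))"
      unfolding integral_neg
      by (rule arg_cong[where f = uminus], rule integral_reflect_unit[OF integrable_add[OF i]])
    finally show ?thesis by (simp add: integral_add[OF i])
  qed
  have "(\<Sum>k<4. side_integral \<phi>1 \<phi>2 \<sigma> k) = side_integral \<phi>1 \<phi>2 \<sigma> 0 + side_integral \<phi>1 \<phi>2 \<sigma> 1
      + side_integral \<phi>1 \<phi>2 \<sigma> 2 + side_integral \<phi>1 \<phi>2 \<sigma> 3"
    by (simp add: eval_nat_numeral)
  then show "integral unit_square (\<lambda>q. (partial_a \<phi>2 (\<sigma> q) - partial_b \<phi>1 (\<sigma> q)) * patch_jacobian \<sigma> q)
      = (\<Sum>k<4. side_integral \<phi>1 \<phi>2 \<sigma> k)"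
    unfolding pt
    by (simp only: integral_add[OF int1[OF \<phi>(1) bl(1)] int1[OF \<phi>(2) bl(2)]]
        green[OF \<phi>(1) bl(1)] green[OF \<phi>(2) bl(2)] e0 e1 e2 e3) (simp add: algebra_simps)
qed

text \<open>Reindexing by \<open>\<tau>\<close> equates the sum with its negative.\<close>

lemma sum_antisymmetric_involution:
  fixes f :: "'a \<Rightarrow> 'b::{real_vector}"
  assumes "\<And>x. x \<in> X \<Longrightarrow> \<tau> x \<in> X" "\<And>x. x \<in> X \<Longrightarrow> \<tau> (\<tau> x) = x" "\<And>x. x \<in> X \<Longrightarrow> f (\<tau> x) = - f x"
  shows "sum f X = 0"
proof -
  have "sum f X = sum (\<lambda>x. f (\<tau> x)) X"
    by (rule sum.reindex_bij_witness[of _ \<tau> \<tau>]) (use assms in auto)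
  also have "\<dots> = - sum f X" using assms(3) by (simp add: sum_negf)
  finally show ?thesis by (metis eq_neg_iff_add_eq_0 scaleR_2 scaleR_eq_0_iff zero_neq_numeral)
qed

lemma continuous_on_one_form_side:
  assumes \<sigma>: "smooth_patch \<sigma>" "k < 4" and sub: "\<sigma> ` unit_square \<subseteq> G"
    and \<phi>: "continuous_on G \<phi>" "continuous_on G \<omega>"
  shows "continuous_on {0..1} (\<lambda>t. one_form \<phi> \<omega> (patch_side \<sigma> k t) (side_deriv \<sigma> k t))"
proof -
  have arc: "regular_arc (patch_side \<sigma> k) (side_deriv \<sigma> k)" by (rule regular_arc_side[OF \<sigma>])
  have im: "patch_side \<sigma> k ` {0..1} \<subseteq> G"
  proof
    fix p assume "p \<in> patch_side \<sigma> k ` {0..1}"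
    then obtain t :: real where t: "t \<in> {0..1}" "p = patch_side \<sigma> k t" by blast
    have "[(t, 0), (1, t), (1 - t, 1), (0, 1 - t)] ! k \<in> unit_square"
      by (rule less_4_cases[OF \<sigma>(2)]) (use t(1) in \<open>simp_all only: nth_4, auto\<close>)
    then have "p \<in> \<sigma> ` unit_square" unfolding t(2) patch_side_def by (rule imageI)
    then show "p \<in> G" using sub by (rule rev_subsetD)
  qed
  have c: "continuous_on {0..1} (side_deriv \<sigma> k)" using arc by (simp add: regular_arc_def)
  show ?thesis
    unfolding one_form_def
    by (intro continuous_on_add continuous_on_mult continuous_on_fst continuous_on_snd c
        continuous_on_compose2[OF \<phi>(1) regular_arc_continuous[OF arc] im]
        continuous_on_compose2[OF \<phi>(2) regular_arc_continuous[OF arc] im])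
qed

text \<open>Seen from the arc of the first side, the second one is a curve in it from parameter 1 to
  parameter 0. Its integral is thereby determined, however the two parametrizations are
  related.\<close>

lemma side_integral_opposite:
  assumes \<sigma>: "smooth_patch \<sigma>" "k < 4" and \<tau>: "smooth_patch \<tau>" "l < 4"
    and sub: "\<sigma> ` unit_square \<subseteq> G"
    and \<phi>: "continuous_on G \<phi>" "continuous_on G \<omega>"
    and im: "path_image (patch_side \<tau> l) = path_image (patch_side \<sigma> k)"
    and ends: "pathstart (patch_side \<tau> l) = pathfinish (patch_side \<sigma> k)"
      "pathfinish (patch_side \<tau> l) = pathstart (patch_side \<sigma> k)"
  shows "side_integral \<phi> \<omega> \<tau> l = - side_integral \<phi> \<omega> \<sigma> k"
proof -
  have arc: "regular_arc (patch_side \<sigma> k) (side_deriv \<sigma> k)" by (rule regular_arc_side[OF \<sigma>])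
  have arc2: "regular_arc (patch_side \<tau> l) (side_deriv \<tau> l)" by (rule regular_arc_side[OF \<tau>])
  have "((\<lambda>t. one_form \<phi> \<omega> (patch_side \<tau> l t) (side_deriv \<tau> l t)) has_integral
      integral {0..0} (\<lambda>s. one_form \<phi> \<omega> (patch_side \<sigma> k s) (side_deriv \<sigma> k s))
      - integral {0..1} (\<lambda>s. one_form \<phi> \<omega> (patch_side \<sigma> k s) (side_deriv \<sigma> k s))) {0..1}"
  proof (rule regular_arc_integral[OF arc regular_arc_continuous[OF arc2], where K = "{}"])
    show "patch_side \<tau> l ` {0..1} \<subseteq> patch_side \<sigma> k ` {0..1}" using im by (simp add: path_image_def)
    show "patch_side \<tau> l 0 = patch_side \<sigma> k 1" "patch_side \<tau> l 1 = patch_side \<sigma> k 0"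
      using ends by (simp_all add: pathstart_def pathfinish_def)
    show "(patch_side \<tau> l has_vector_derivative side_deriv \<tau> l t) (at t)" if "t \<in> {0<..<1} - {}" for t
    proof -
      have t: "0 < t" "t < 1" using that by auto
      have "(patch_side \<tau> l has_vector_derivative side_deriv \<tau> l t) (at t within {0..1})"
        using arc2 t by (simp add: regular_arc_def)
      then show ?thesis by (simp only: at_within_Icc_at[OF t])
    qed
    show "linear (one_form \<phi> \<omega> p)" for p by (rule linear_one_form)
    show "continuous_on {0..1} (\<lambda>s. one_form \<phi> \<omega> (patch_side \<sigma> k s) (side_deriv \<sigma> k s))"
      by (rule continuous_on_one_form_side[OF \<sigma> sub \<phi>])
  qed auto
  then show ?thesis unfolding side_integral_def by (simp add: integral_unique)
qed

lemma patch_side_ends_distinct: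
  assumes "smooth_patch \<sigma>" "k < 4"
  shows "pathstart (patch_side \<sigma> k) \<noteq> pathfinish (patch_side \<sigma> k)"
  using regular_arc_eq_iff[OF regular_arc_side[OF assms], of 0 1]
  unfolding pathstart_def pathfinish_def by simp

lemma patch_side_image_unique:
  assumes "smooth_patch \<sigma>" "k < 4" "l < 4"
    "path_image (patch_side \<sigma> k) = path_image (patch_side \<sigma> l)"
  shows "k = l"
proof -
  have "patch_side \<sigma> k (1/2) \<in> path_image (patch_side \<sigma> k)"
    unfolding path_image_def by (rule imageI) simp
  then obtain t where "t \<in> {0..1}" "patch_side \<sigma> k (1/2) = patch_side \<sigma> l t"
    unfolding assms(4) unfolding path_image_def by blast
  then show ?thesis using patch_side_interior_unique[OF assms(1-3), of "1/2" t] by simp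
qed

section \<open>Pairing the sides of the patches\<close>

definition side_ids :: "patch list \<Rightarrow> (nat \<times> nat) set" where
  "side_ids S = {..<length S} \<times> {..<4}"

definition side_of :: "patch list \<Rightarrow> nat \<times> nat \<Rightarrow> real \<Rightarrow> point" where
  "side_of S x = patch_side (S ! fst x) (snd x)"

text \<open>A partial involution on the indices of sides: symmetric, single-valued because common
  sides have opposite directions, and undefined exactly at the boundary sides.\<close>

definition partners :: "patch list \<Rightarrow> nat \<times> nat \<Rightarrow> nat \<times> nat \<Rightarrow> bool" where
  "partners S x y \<longleftrightarrow> x \<in> side_ids S \<and> y \<in> side_ids S \<and> fst x \<noteq> fst y \<and>
     path_image (side_of S x) = path_image (side_of S y)"

context
  fixes S :: "patch list"
  assumes S: "oriented_surface S"
begin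

lemma smooth_nth: "i < length S \<Longrightarrow> smooth_patch (S ! i)"
  using S unfolding oriented_surface_def by auto

lemma common_side_opposite:
  assumes "i < length S" "j < length S" "i \<noteq> j" "k < 4" "l < 4"
    "path_image (patch_side (S ! i) k) = path_image (patch_side (S ! j) l)"
  shows "pathstart (patch_side (S ! i) k) = pathfinish (patch_side (S ! j) l)"
    "pathfinish (patch_side (S ! i) k) = pathstart (patch_side (S ! j) l)"
  using S assms unfolding oriented_surface_def by blast+

lemma patches_meet:
  assumes "i < length S" "j < length S" "i \<noteq> j"
    "p \<in> (S ! i) ` unit_square" "p \<in> (S ! j) ` unit_square"
  shows "p \<in> patch_corners (S ! i) \<or>
    (\<exists>k<4. \<exists>l<4. p \<in> path_image (patch_side (S ! i) k) \<and>
       path_image (patch_side (S ! i) k) = path_image (patch_side (S ! j) l))"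
  using S assms unfolding oriented_surface_def by blast

lemma partners_sym: "partners S x y \<Longrightarrow> partners S y x"
  by (auto simp: partners_def)

lemma partners_ends:
  assumes "partners S x y"
  shows "pathstart (side_of S x) = pathfinish (side_of S y)" "pathfinish (side_of S x) = pathstart (side_of S y)"
  using assms common_side_opposite[of "fst x" "fst y" "snd x" "snd y"]
  by (auto simp: partners_def side_of_def side_ids_def)

text \<open>A third patch along the same side would run through it in both directions.\<close>

lemma partners_unique:
  assumes "partners S x y" "partners S x z"
  shows "y = z"
proof (rule ccontr)
  assume ne: "y \<noteq> z"
  have im: "path_image (side_of S y) = path_image (side_of S z)" using assms by (simp add: partners_def)
  have ids: "y \<in> side_ids S" "z \<in> side_ids S" using assms by (simp_all add: partners_def)
  show False
  proof (cases "fst y = fst z")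
    case True
    have "snd y = snd z"
      using patch_side_image_unique[OF smooth_nth, of "fst y" "snd y" "snd z"] ids im True
      by (auto simp: side_ids_def side_of_def)
    then show False using True ne by (simp add: prod_eq_iff)
  next
    case False
    then have "partners S y z" using ids im by (simp add: partners_def)
    then have "pathstart (side_of S y) = pathfinish (side_of S y)"
      using partners_ends[OF assms(1)] partners_ends[OF assms(2)] partners_ends[of y z] by simp
    then show False
      using patch_side_ends_distinct[OF smooth_nth, of "fst y" "snd y"] ids
      by (auto simp: side_ids_def side_of_def)
  qed
qed

lemma boundary_sides_iff:
  "x \<in> boundary_sides S \<longleftrightarrow> x \<in> side_ids S \<and> (\<nexists>y. partners S x y)"
  by (cases x) (fastforce simp: boundary_sides_def side_ids_def partners_def side_of_def)

text \<open>Passing to the partner is an involution of these sides, since uniqueness makes the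
  choice of a partner canonical, and it changes the sign of the integral.\<close>

lemma sum_interior_sides:
  assumes sub: "surface_set S \<subseteq> G" and \<phi>: "continuous_on G \<phi>" "continuous_on G \<omega>"
  shows "(\<Sum>x\<in>side_ids S - boundary_sides S. side_integral \<phi> \<omega> (S ! fst x) (snd x)) = 0"
proof (rule sum_antisymmetric_involution)
  define \<tau> where "\<tau> x = (SOME y. partners S x y)" for x
  fix x assume "x \<in> side_ids S - boundary_sides S"
  then have "\<exists>y. partners S x y" using boundary_sides_iff by blast
  then have \<tau>: "partners S x (\<tau> x)" unfolding \<tau>_def by (rule someI_ex)
  have "\<tau> x \<in> side_ids S" using \<tau> by (simp add: partners_def)
  then show "\<tau> x \<in> side_ids S - boundary_sides S"
    using boundary_sides_iff partners_sym[OF \<tau>] by blast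
  have "partners S (\<tau> x) (\<tau> (\<tau> x))"
    unfolding \<tau>_def[of "\<tau> x"] by (rule someI) (rule partners_sym[OF \<tau>])
  then show "\<tau> (\<tau> x) = x" using partners_unique partners_sym[OF \<tau>] by blast
  have ids: "fst x < length S" "snd x < 4" "fst (\<tau> x) < length S" "snd (\<tau> x) < 4"
    using \<tau> by (auto simp: partners_def side_ids_def)
  show "side_integral \<phi> \<omega> (S ! fst (\<tau> x)) (snd (\<tau> x)) = - side_integral \<phi> \<omega> (S ! fst x) (snd x)"
  proof (rule side_integral_opposite[OF smooth_nth ids(2) smooth_nth ids(4) _ \<phi>])
    show "(S ! fst x) ` unit_square \<subseteq> G"
      using sub ids(1) nth_mem unfolding surface_set_def by blast
  qed (use ids \<tau> partners_ends[OF \<tau>] in \<open>simp_all add: partners_def side_of_def\<close>)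
qed

text \<open>A point inside a side is not a corner, so two patches can share it only along a common
  side. Lying inside \<open>x\<close>, it belongs to no other side of that patch, so the common side
  is \<open>x\<close> itself, which would then have a partner.\<close>

lemma boundary_sides_disjoint:
  assumes x: "x \<in> boundary_sides S" and y: "y \<in> boundary_sides S" and "x \<noteq> y"
  shows "side_of S x ` {0<..<1} \<inter> side_of S y ` {0..1} = {}"
proof (rule equals0I)
  fix p assume "p \<in> side_of S x ` {0<..<1} \<inter> side_of S y ` {0..1}"
  then obtain s t where s: "s \<in> {0<..<1}" "p = side_of S x s" and t: "t \<in> {0..1}" "p = side_of S y t"
    by blast
  have ids: "fst x < length S" "snd x < 4" "fst y < length S" "snd y < 4"
    using x y by (auto simp: boundary_sides_iff side_ids_def)
  have in_sq: "side_of S z r \<in> (S ! fst z) ` unit_square" if "snd z < 4" "r \<in> {0..1}" for z r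
  proof -
    have "[(r, 0), (1, r), (1 - r, 1), (0, 1 - r)] ! snd z \<in> unit_square"
      by (rule less_4_cases[OF that(1)]) (use that(2) in \<open>simp_all only: nth_4, auto\<close>)
    then show ?thesis unfolding side_of_def patch_side_def by (rule imageI)
  qed
  show False
  proof (cases "fst x = fst y")
    case True
    then have "snd x = snd y"
      using patch_side_interior_unique[OF smooth_nth[OF ids(1)] ids(2,4) s(1) t(1)] s(2) t(2)
      by (simp add: side_of_def)
    then show False using True \<open>x \<noteq> y\<close> by (simp add: prod_eq_iff)
  next
    case False
    have "p \<in> (S ! fst x) ` unit_square" using in_sq[OF ids(2), of s] s by auto
    moreover have "p \<in> (S ! fst y) ` unit_square" using in_sq[OF ids(4) t(1)] t by auto
    moreover have "p \<notin> patch_corners (S ! fst x)"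
      using patch_side_interior_not_corner[OF smooth_nth[OF ids(1)] ids(2) s(1)] s(2)
      by (simp add: side_of_def)
    ultimately obtain k l where kl: "k < 4" "l < 4" "p \<in> path_image (patch_side (S ! fst x) k)"
      "path_image (patch_side (S ! fst x) k) = path_image (patch_side (S ! fst y) l)"
      using patches_meet[OF ids(1,3) False] by blast
    obtain r where r: "r \<in> {0..1}" "p = patch_side (S ! fst x) k r"
      using kl(3) by (auto simp: path_image_def)
    have "snd x = k"
      using patch_side_interior_unique[OF smooth_nth[OF ids(1)] ids(2) kl(1) s(1) r(1)] s(2) r(2)
      by (simp add: side_of_def)
    then have "partners S x (fst y, l)"
      using kl ids False by (simp add: partners_def side_ids_def side_of_def mem_Times_iff)
    then show False using x boundary_sides_iff by blast
  qed
qed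

end

theorem theorem5p4:
  fixes G :: "(complex \<times> complex) set"
    and \<phi>1 \<phi>2 :: "complex \<times> complex \<Rightarrow> complex"
    and S :: "patch list"
    and \<Gamma> :: "real \<Rightarrow> complex \<times> complex"
  assumes "open G" and "connected G"
    and "holomorphic2_on \<phi>1 G" and "holomorphic2_on \<phi>2 G"
    and "oriented_surface S" and "surface_set S \<subseteq> G"
    and "bounded_by S \<Gamma>"
  shows "complex_line_integral \<phi>1 \<phi>2 \<Gamma> =
         complex_surface_integral (\<lambda>p. partial_a \<phi>2 p - partial_b \<phi>1 p) S"
proof -
  have b: "bounded_holomorphic2_on \<phi>1 G" "bounded_holomorphic2_on \<phi>2 G"
    using assms hartogs by blast+
  have c: "continuous_on G \<phi>1" "continuous_on G \<phi>2"
    using b by (blast intro: bounded_holomorphic2_on_continuous)+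
  note S = \<open>oriented_surface S\<close>
  have smooth: "smooth_patch \<sigma>" if "\<sigma> \<in> set S" for \<sigma> using S that by (simp add: oriented_surface_def)
  have sub: "\<sigma> ` unit_square \<subseteq> G" if "\<sigma> \<in> set S" for \<sigma>
    using assms(6) that unfolding surface_set_def by blast
  define I where "I x = side_integral \<phi>1 \<phi>2 (S ! fst x) (snd x)" for x
  let ?B = "boundary_sides S"
  have BA: "?B \<subseteq> side_ids S" using boundary_sides_iff[OF S] by blast
  have finA: "finite (side_ids S)" by (simp add: side_ids_def)
  have "complex_surface_integral (\<lambda>p. partial_a \<phi>2 p - partial_b \<phi>1 p) S
      = (\<Sum>\<sigma>\<leftarrow>S. integral unit_square (\<lambda>q. (partial_a \<phi>2 (\<sigma> q) - partial_b \<phi>1 (\<sigma> q)) * patch_jacobian \<sigma> q))"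
    by (rule complex_surface_integral_eq) (rule patch_stokes(1)[OF smooth sub assms(1) b])
  also have "\<dots> = (\<Sum>\<sigma>\<leftarrow>S. \<Sum>k<4. side_integral \<phi>1 \<phi>2 \<sigma> k)"
    by (rule arg_cong[where f = sum_list], rule map_cong[OF refl])
       (rule patch_stokes(2)[OF smooth sub assms(1) b])
  also have "\<dots> = (\<Sum>i<length S. \<Sum>k<4. I (i, k))"
    by (simp add: sum_list_sum_nth atLeast0LessThan I_def)
  also have "\<dots> = sum I (side_ids S)"
    by (simp add: sum.cartesian_product side_ids_def)
  also have "\<dots> = sum I ?B + sum I (side_ids S - ?B)"
    using sum.subset_diff[OF BA finA, of I] by simp
  also have "sum I (side_ids S - ?B) = 0"
    unfolding I_def by (rule sum_interior_sides[OF S assms(6) c])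
  finally have surf: "complex_surface_integral (\<lambda>p. partial_a \<phi>2 p - partial_b \<phi>1 p) S = sum I ?B" by simp
  have \<Gamma>: "valid_path \<Gamma>" "simple_path \<Gamma>" "pathfinish \<Gamma> = pathstart \<Gamma>"
    and image: "path_image \<Gamma> = (\<Union>(i, k)\<in>?B. path_image (patch_side (S ! i) k))"
    and orient: "\<And>i k s t. (i, k) \<in> ?B \<Longrightarrow> s \<in> {0<..<1} \<Longrightarrow> t \<in> {0<..<1} \<Longrightarrow>
       \<Gamma> t = patch_side (S ! i) k s \<Longrightarrow> \<Gamma> differentiable (at t) \<Longrightarrow>
       \<exists>c\<ge>0. vector_derivative \<Gamma> (at t) = c *\<^sub>R vector_derivative (patch_side (S ! i) k) (at s)"
    using assms(7) unfolding bounded_by_def by blast+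
  obtain K where K: "finite K" "\<And>t. t \<in> {0..1} - K \<Longrightarrow> \<Gamma> differentiable (at t)"
    using \<Gamma>(1) unfolding valid_path_def piecewise_C1_differentiable_on_def C1_differentiable_on_eq by blast
  have arcs: "regular_arc (side_of S x) (side_deriv (S ! fst x) (snd x))" if "x \<in> ?B" for x
    unfolding side_of_def
    using that BA by (intro regular_arc_side smooth_nth[OF S]) (auto simp: side_ids_def)
  have "((\<lambda>t. one_form \<phi>1 \<phi>2 (\<Gamma> t) (vector_derivative \<Gamma> (at t))) has_integral
      (\<Sum>x\<in>?B. integral {0..1} (\<lambda>s. one_form \<phi>1 \<phi>2 (side_of S x s) (side_deriv (S ! fst x) (snd x) s)))) {0..1}"
  proof (rule loop_integral[where K = K and e = "side_of S" and W = "one_form \<phi>1 \<phi>2"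
        and d = "\<lambda>x. side_deriv (S ! fst x) (snd x)"])
    show "finite ?B" using BA finA by (rule finite_subset)
    show "path_image \<Gamma> = (\<Union>x\<in>?B. side_of S x ` {0..1})"
      using image by (simp add: side_of_def path_image_def split_beta)
    show "(\<Gamma> has_vector_derivative vector_derivative \<Gamma> (at t)) (at t)" if "t \<in> {0<..<1} - K" for t
      using K(2)[of t] that by (simp add: vector_derivative_works)
    show "\<exists>c\<ge>0. vector_derivative \<Gamma> (at t) = c *\<^sub>R side_deriv (S ! fst x) (snd x) s"
      if x: "x \<in> ?B" and t: "t \<in> {0<..<1} - K" and s: "s \<in> {0<..<1}" and eq: "\<Gamma> t = side_of S x s" for x t s
    proof -
      have s': "0 < s" "s < 1" using s by auto
      \<comment> \<open>In the open interval the one-sided derivative of a side is the ordinary one,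
        which occurs in \<open>bounded_by\<close>.\<close>
      have "(side_of S x has_vector_derivative side_deriv (S ! fst x) (snd x) s) (at s within {0..1})"
        using arcs[OF x] s' by (simp add: regular_arc_def)
      then have "(side_of S x has_vector_derivative side_deriv (S ! fst x) (snd x) s) (at s)"
        by (simp only: at_within_Icc_at[OF s'])
      then have "vector_derivative (side_of S x) (at s) = side_deriv (S ! fst x) (snd x) s"
        by (rule vector_derivative_at)
      moreover have "\<exists>c\<ge>0. vector_derivative \<Gamma> (at t) = c *\<^sub>R vector_derivative (side_of S x) (at s)"
        unfolding side_of_def
        by (rule orient) (use x t s eq K(2)[of t] in \<open>auto simp: side_of_def\<close>)
      ultimately show ?thesis by simp
    qed
    show "continuous_on {0..1} (\<lambda>s. one_form \<phi>1 \<phi>2 (side_of S x s) (side_deriv (S ! fst x) (snd x) s))"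
      if x: "x \<in> ?B" for x
    proof -
      have ids: "fst x < length S" "snd x < 4" using x BA by (auto simp: side_ids_def)
      show ?thesis
        unfolding side_of_def
        by (rule continuous_on_one_form_side[OF smooth_nth[OF S ids(1)] ids(2) sub[OF nth_mem[OF ids(1)]] c])
    qed
  qed (use arcs boundary_sides_disjoint[OF S] \<Gamma> K linear_one_form in auto)
  then have "((\<lambda>t. one_form \<phi>1 \<phi>2 (\<Gamma> t) (vector_derivative \<Gamma> (at t))) has_integral sum I ?B) {0..1}"
    by (simp add: I_def side_integral_def side_of_def)
  \<comment> \<open>The line integral is defined with derivatives relative to \<open>{0..1}\<close>;
    they can differ from the two-sided ones only at 0 and 1.\<close>
  then have "((\<lambda>t. one_form \<phi>1 \<phi>2 (\<Gamma> t) (vector_derivative \<Gamma> (at t within {0..1}))) has_integral sum I ?B) {0..1}"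
    by (rule has_integral_spike_finite[of "{0, 1}", rotated 2]) (auto simp: at_within_Icc_at)
  then have "complex_line_integral \<phi>1 \<phi>2 \<Gamma> = sum I ?B" by (rule complex_line_integral_eq)
  then show ?thesis using surf by simp
qed

end
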